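(* Up to isomorphism, there exist three four-dimensional solvable Leibniz algebras over $\mathbb{C}$ with three-dimensional rigid nilradical (the first one depending on a parameter). Namely, they are the following algebras with basis $\{x,e_1,e_2,e_3\}$ (omitted products are zero): $R_1^4$: $[e_2,e_1]=e_3$, $[e_1,e_2]=\beta e_3$, $[x,e_1]=-e_1$, $[x,e_2]=-\beta e_2$, $[e_1,x]=e_1$, $[e_2,x]=\beta e_2$, $[e_3,x]=(\beta+1)e_3$, where $\beta=\frac{\sqrt{1-4\alpha}-1}{\sqrt{1-4\alpha}+1}$ for $\alpha\in\mathbb{C}$, $\alpha\neq 0,\frac14$; $R_2^4$: $[e_2,e_1]=e_3$, $[e_1,e_2]=e_3$, $[x,e_1]=-e_1$, $[x,e_2]=-e_2$, $[e_1,x]=e_1$, $[e_2,x]=e_2$, $[e_3,x]=2e_3$; $R_3^4$: $[e_1,e_1]=e_2$, $[e_2,e_1]=e_3$, $[x,e_1]=-e_1$, $[e_1,x]=e_1$, $[e_2,x]=2e_2$, $[e_3,x]=3e_3$.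
   Context: All algebras are finite-dimensional over $\mathbb{C}$. A (right) Leibniz algebra is a vector space $L$ with a bilinear bracket satisfying $[x,[y,z]]=[[x,y],z]-[[x,z],y]$ for all $x,y,z\in L$. It is nilpotent if its lower central series $L^1=L$, $L^{k+1}=[L^k,L]$ reaches $0$, and solvable if its derived series reaches $0$. The nilradical is the maximal nilpotent ideal. The three-dimensional nilpotent rigid Leibniz algebras are understood to be, by a known classification, the following (basis $e_1,e_2,e_3$, omitted products zero): $\lambda_4(\alpha)$, $\alpha\neq0$: $[e_1,e_1]=e_3$, $[e_2,e_2]=\alpha e_3$, $[e_1,e_2]=e_3$; $\lambda_5$: $[e_2,e_1]=e_3$, $[e_1,e_2]=e_3$; $\lambda_6$: $[e_1,e_1]=e_2$, $[e_2,e_1]=e_3$. Thus "with three-dimensional rigid nilradical" means that the nilradical is isomorphic to one of these algebras. *)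

theory Defs
  imports "HOL-Analysis.Analysis"
begin

locale leibniz_algebra = vector_space scale
  for scale :: "complex \<Rightarrow> 'a::ab_group_add \<Rightarrow> 'a" +
  fixes bracket :: "'a \<Rightarrow> 'a \<Rightarrow> 'a"
  assumes linear_bracket_left: "\<And>v. Vector_Spaces.linear scale scale (\<lambda>u. bracket u v)"
    and linear_bracket_right: "\<And>u. Vector_Spaces.linear scale scale (\<lambda>v. bracket u v)"
    and leibniz_identity:
      "\<And>x y z. bracket x (bracket y z) = bracket (bracket x y) z - bracket (bracket x z) y"
begin

definition product :: "'a set \<Rightarrow> 'a set \<Rightarrow> 'a set" where
  "product A B = span {bracket a b | a b. a \<in> A \<and> b \<in> B}"

text \<open>The subset \<open>I\<close> plays the role of a subalgebra, considered as an algebra in its own right.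
  Numbering starts at \<open>0\<close>, so \<open>lower_central_series I k\<close> is usually written $I^{k+1}$.\<close>

primrec lower_central_series :: "'a set \<Rightarrow> nat \<Rightarrow> 'a set" where
  "lower_central_series I 0 = I"
| "lower_central_series I (Suc k) = product (lower_central_series I k) I"

primrec derived_series :: "'a set \<Rightarrow> nat \<Rightarrow> 'a set" where
  "derived_series I 0 = I"
| "derived_series I (Suc k) = product (derived_series I k) (derived_series I k)"

definition nilpotent :: "'a set \<Rightarrow> bool" where
  "nilpotent I \<longleftrightarrow> (\<exists>k. lower_central_series I k = {0})"

definition solvable :: "'a set \<Rightarrow> bool" where
  "solvable I \<longleftrightarrow> (\<exists>k. derived_series I k = {0})"

definition is_ideal :: "'a set \<Rightarrow> bool" where
  "is_ideal I \<longleftrightarrow> subspace I \<and> (\<forall>u. \<forall>v\<in>I. bracket u v \<in> I \<and> bracket v u \<in> I)"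

definition is_nilradical :: "'a set \<Rightarrow> bool" where
  "is_nilradical N \<longleftrightarrow>
     is_ideal N \<and> nilpotent N \<and> (\<forall>I. is_ideal I \<and> nilpotent I \<longrightarrow> I \<subseteq> N)"

end

text \<open>Isomorphism of the (sub)algebras carried by the subspaces \<open>A\<close> and \<open>B\<close>.\<close>

definition algebra_isomorphic ::
  "(complex \<Rightarrow> 'a::ab_group_add \<Rightarrow> 'a) \<Rightarrow> ('a \<Rightarrow> 'a \<Rightarrow> 'a) \<Rightarrow> 'a set \<Rightarrow>
   (complex \<Rightarrow> 'b::ab_group_add \<Rightarrow> 'b) \<Rightarrow> ('b \<Rightarrow> 'b \<Rightarrow> 'b) \<Rightarrow> 'b set \<Rightarrow> bool" where
  "algebra_isomorphic scale1 bracket1 A scale2 bracket2 B \<longleftrightarrow>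
     (\<exists>f. bij_betw f A B \<and>
          (\<forall>u\<in>A. \<forall>v\<in>A. f (u + v) = f u + f v) \<and>
          (\<forall>c. \<forall>u\<in>A. f (scale1 c u) = scale2 c (f u)) \<and>
          (\<forall>u\<in>A. \<forall>v\<in>A. f (bracket1 u v) = bracket2 (f u) (f v)))"

text \<open>The bilinear product for which \<open>T i j\<close> is the product of the \<open>i\<close>-th and the \<open>j\<close>-th
  standard basis vectors.\<close>

definition bracket_of_table ::
  "('n \<Rightarrow> 'n \<Rightarrow> complex ^ 'n) \<Rightarrow> complex ^ 'n \<Rightarrow> complex ^ 'n \<Rightarrow> complex ^ 'n::finite" where
  "bracket_of_table T u v = (\<Sum>i\<in>UNIV. \<Sum>j\<in>UNIV. (u $ i * v $ j) *s T i j)"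

definition e :: "'n \<Rightarrow> complex ^ 'n::finite" where
  "e i = axis i 1"

definition lambda4 :: "complex \<Rightarrow> complex ^ 3 \<Rightarrow> complex ^ 3 \<Rightarrow> complex ^ 3" where
  "lambda4 \<alpha> = bracket_of_table (\<lambda>i j.
     if (i, j) = (1, 1) then e 3
     else if (i, j) = (2, 2) then \<alpha> *s e 3
     else if (i, j) = (1, 2) then e 3
     else 0)"

definition lambda5 :: "complex ^ 3 \<Rightarrow> complex ^ 3 \<Rightarrow> complex ^ 3" where
  "lambda5 = bracket_of_table (\<lambda>i j.
     if (i, j) = (2, 1) then e 3
     else if (i, j) = (1, 2) then e 3
     else 0)"

definition lambda6 :: "complex ^ 3 \<Rightarrow> complex ^ 3 \<Rightarrow> complex ^ 3" where
  "lambda6 = bracket_of_table (\<lambda>i j.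
     if (i, j) = (1, 1) then e 2
     else if (i, j) = (2, 1) then e 3
     else 0)"

text \<open>In dimension four the basis vector $x$ is \<open>e 0\<close>; the index type \<open>4\<close> consists of
  \<open>0, 1, 2, 3\<close>.\<close>

definition R1 :: "complex \<Rightarrow> complex ^ 4 \<Rightarrow> complex ^ 4 \<Rightarrow> complex ^ 4" where
  "R1 \<beta> = bracket_of_table (\<lambda>i j.
     if (i, j) = (2, 1) then e 3
     else if (i, j) = (1, 2) then \<beta> *s e 3
     else if (i, j) = (0, 1) then - e 1
     else if (i, j) = (0, 2) then - (\<beta> *s e 2)
     else if (i, j) = (1, 0) then e 1
     else if (i, j) = (2, 0) then \<beta> *s e 2
     else if (i, j) = (3, 0) then (\<beta> + 1) *s e 3
     else 0)"

text \<open>With the principal square root the denominator never vanishes.  The other square root would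
  replace \<open>\<beta>\<close> by its inverse (for \<open>\<alpha> \<noteq> 0\<close>), which gives an isomorphic algebra \<open>R1 \<beta>\<close>.\<close>

definition beta :: "complex \<Rightarrow> complex" where
  "beta \<alpha> = (csqrt (1 - 4 * \<alpha>) - 1) / (csqrt (1 - 4 * \<alpha>) + 1)"

definition R2 :: "complex ^ 4 \<Rightarrow> complex ^ 4 \<Rightarrow> complex ^ 4" where
  "R2 = bracket_of_table (\<lambda>i j.
     if (i, j) = (2, 1) then e 3
     else if (i, j) = (1, 2) then e 3
     else if (i, j) = (0, 1) then - e 1
     else if (i, j) = (0, 2) then - e 2
     else if (i, j) = (1, 0) then e 1
     else if (i, j) = (2, 0) then e 2
     else if (i, j) = (3, 0) then 2 *s e 3
     else 0)"

definition R3 :: "complex ^ 4 \<Rightarrow> complex ^ 4 \<Rightarrow> complex ^ 4" where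
  "R3 = bracket_of_table (\<lambda>i j.
     if (i, j) = (1, 1) then e 2
     else if (i, j) = (2, 1) then e 3
     else if (i, j) = (0, 1) then - e 1
     else if (i, j) = (1, 0) then e 1
     else if (i, j) = (2, 0) then 2 *s e 2
     else if (i, j) = (3, 0) then 3 *s e 3
     else 0)"

text \<open>The rigid three-dimensional nilpotent Leibniz algebras are given by their known
  classification.\<close>

definition is_rigid_nilpotent_3 ::
  "(complex \<Rightarrow> 'a::ab_group_add \<Rightarrow> 'a) \<Rightarrow> ('a \<Rightarrow> 'a \<Rightarrow> 'a) \<Rightarrow> 'a set \<Rightarrow> bool" where
  "is_rigid_nilpotent_3 smul bracket N \<longleftrightarrow>
     (\<exists>\<alpha>. \<alpha> \<noteq> 0 \<and> algebra_isomorphic smul bracket N (*s) (lambda4 \<alpha>) UNIV) \<or>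
     algebra_isomorphic smul bracket N (*s) lambda5 UNIV \<or>
     algebra_isomorphic smul bracket N (*s) lambda6 UNIV"

definition solvable_4_rigid_nilradical_3 ::
  "(complex \<Rightarrow> 'a::ab_group_add \<Rightarrow> 'a) \<Rightarrow> ('a \<Rightarrow> 'a \<Rightarrow> 'a) \<Rightarrow> bool" where
  "solvable_4_rigid_nilradical_3 smul bracket \<longleftrightarrow>
     leibniz_algebra smul bracket \<and>
     vector_space.dim smul (UNIV :: 'a set) = 4 \<and>
     leibniz_algebra.solvable smul bracket UNIV \<and>
     (\<exists>N. leibniz_algebra.is_nilradical smul bracket N \<and> is_rigid_nilpotent_3 smul bracket N)"

end

theory Submission
  imports Defs
begin

text \<open>The three families of four-dimensional algebras are the non-nilpotent extensions, by one vector \<open>x\<close>, of the nilpotent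
algebras \<open>lambda4 \<alpha>\<close>, \<open>lambda5\<close> and \<open>lambda6\<close>. If the nilradical \<open>N\<close> of a four-dimensional Leibniz algebra has dimension
three, any \<open>x\<close> outside \<open>N\<close> completes a basis of \<open>N\<close> to a basis of the algebra, and only the products with \<open>x\<close> are unknown
(\<open>structure_constants_exist\<close>). They are strongly restricted by the Leibniz identity: right multiplication by \<open>x\<close> is a
derivation of \<open>N\<close>, squares and symmetric products annihilate the algebra from the right, and therefore left multiplication
by \<open>x\<close> is the negative of right multiplication up to such annihilators. If the derivation were nilpotent,
the whole algebra would be nilpotent, against the maximality of \<open>N\<close>. So it has a nonzero eigenvalue, which
scaling \<open>x\<close> turns into \<open>1\<close>, and a change of basis leads to the normal form.

The algebras \<open>lambda4 \<alpha>\<close> and \<open>lambda5\<close> are bilinear forms $A$ on a plane with values in a line. For these the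
Leibniz identity gives $2SD = \lambda A$, where $S$ is the symmetric part of $A$ and $D$ the derivation on the plane.
In a basis of isotropic vectors $A$ has the entries $\beta$ and $1$ off the diagonal, and $D$ becomes a multiple of the
diagonal matrix with entries $1$ and $\beta$, which is \<open>R1 \<beta>\<close>; \<open>lambda5\<close> is the case $\beta = 1$, and indeed \<open>R2 = R1 1\<close>. For
$\alpha = 1/4$ the form $S$ is degenerate, which forces $\lambda = 0$ and a nilpotent $D$, so this value does not
occur (\<open>plane_form_extension\<close>). The algebra \<open>lambda6\<close> is generated by \<open>e 1\<close>, and its derivations are determined by their
value there (\<open>lambda6_extension\<close>).

Conversely, right multiplication by a vector outside the hyperplane \<open>u $ 0 = 0\<close> is not nilpotent on it, so the hyperplane is
the nilradical in each family (\<open>nilradical_of_extension\<close>). An isomorphism from \<open>R1 \<beta>\<close> to \<open>R1 \<gamma>\<close> preserves the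
eigenvalues of right multiplications, up to a common factor, and hence \<open>\<beta>\<close> up to inversion
(\<open>R1_isomorphic_R1_imp\<close>); $\alpha = -\beta/(1-\beta)^2$ is invariant under this inversion. \<open>R3\<close> is set apart by its
nonzero triple products in the nilradical (\<open>R1_not_isomorphic_R3\<close>).\<close>

section \<open>Nilpotency, solvability and isomorphism\<close>

lemma UNIV4: "(UNIV::4 set) = {0,1,2,3}"
  using UNIV_4 by auto

lemma all4: "(\<forall>i::4. P i) \<longleftrightarrow> P 0 \<and> P 1 \<and> P 2 \<and> P 3"
  by (metis UNIV4 UNIV_I insert_iff singletonD)

lemma sum4: "sum f (UNIV::4 set) = f 0 + f 1 + f 2 + f 3"
  unfolding UNIV4 by (simp add: algebra_simps)

lemma (in leibniz_algebra) lower_central_series_subset_filtration: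
  assumes "I \<subseteq> F 0" and "\<And>k. subspace (F k)"
    and "\<And>k u v. u \<in> F k \<Longrightarrow> v \<in> I \<Longrightarrow> bracket u v \<in> F (Suc k)"
  shows "lower_central_series I k \<subseteq> F k"
proof (induction k)
  case 0
  then show ?case using assms(1) by simp
next
  case (Suc k)
  then have "{bracket u v |u v. u \<in> lower_central_series I k \<and> v \<in> I} \<subseteq> F (Suc k)"
    using assms(3) by blast
  then show ?case
    using assms(2) by (simp add: product_def span_minimal)
qed

text \<open>The filtration of the preceding lemma is the flag of the subspaces on which the first coordinates vanish. The
assumption \<open>lowered\<close> says that right multiplication by an element of \<open>I\<close> is strictly triangular for it.\<close>

lemma (in leibniz_algebra) nilpotent_if_coordinates_lowered:
  fixes c :: "nat \<Rightarrow> 'a \<Rightarrow> complex"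
  assumes add: "\<And>k u v. c k (u + v) = c k u + c k v"
    and scale: "\<And>k a u. c k (scale a u) = a * c k u"
    and separating: "\<And>u. (\<And>k. k < d \<Longrightarrow> c k u = 0) \<Longrightarrow> u = 0"
    and lowered: "\<And>u v k. v \<in> I \<Longrightarrow> k < d \<Longrightarrow> (\<And>i. i < k \<Longrightarrow> c i u = 0) \<Longrightarrow> c k (bracket u v) = 0"
  shows "nilpotent I"
proof -
  define F where "F m = {u. \<forall>k<m. k < d \<longrightarrow> c k u = 0}" for m
  have zero: "c k 0 = 0" for k
    using scale[of k 0 0] by simp
  have "lower_central_series I (Suc d) \<subseteq> F (Suc d)"
  proof (rule lower_central_series_subset_filtration)
    show "I \<subseteq> F 0" by (simp add: F_def)
    show "subspace (F k)" for k
      by (simp add: F_def subspace_def add scale zero)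
    show "bracket u v \<in> F (Suc k)" if "u \<in> F k" "v \<in> I" for k u v
      using that lowered[of v _ u] by (auto simp: F_def)
  qed
  also have "\<dots> \<subseteq> {0}"
    using separating by (auto simp: F_def)
  finally have "lower_central_series I (Suc d) = {0}"
    using span_zero by (auto simp: product_def)
  then show ?thesis by (auto simp: nilpotent_def simp del: lower_central_series.simps)
qed

lemma (in leibniz_algebra) product_mono: "A \<subseteq> A' \<Longrightarrow> B \<subseteq> B' \<Longrightarrow> product A B \<subseteq> product A' B'"
  unfolding product_def by (rule span_mono) blast

text \<open>From its second term on, the derived series of the algebra lies in the lower central series of \<open>N\<close>.\<close>

lemma (in leibniz_algebra) solvable_if_product_in_nilpotent:
  assumes "product UNIV UNIV \<subseteq> N" "nilpotent N"
  shows "solvable UNIV"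
proof -
  have "derived_series UNIV (Suc k) \<subseteq> lower_central_series N k \<and> derived_series UNIV (Suc k) \<subseteq> N" for k
  proof (induction k)
    case 0
    then show ?case using assms(1) by simp
  next
    case (Suc k)
    have "derived_series UNIV (Suc (Suc k)) \<subseteq> N"
      using assms(1) product_mono[of _ UNIV _ UNIV]  by (metis derived_series.simps(2) subset_UNIV subset_trans)
    with Suc show ?case
      using product_mono by simp
  qed
  moreover obtain k where "lower_central_series N k = {0}"
    using assms(2) by (auto simp: nilpotent_def)
  ultimately have "derived_series UNIV (Suc k) \<subseteq> {0}" by blast
  then have "derived_series UNIV (Suc k) = {0}"
    using span_zero by (auto simp: product_def)
  then show ?thesis unfolding solvable_def by blast
qed

lemma algebra_isomorphic_sym:
  assumes "algebra_isomorphic s1 b1 A s2 b2 B"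
    and "\<And>u v. u \<in> A \<Longrightarrow> v \<in> A \<Longrightarrow> u + v \<in> A"
    and "\<And>c u. u \<in> A \<Longrightarrow> s1 c u \<in> A"
    and "\<And>u v. u \<in> A \<Longrightarrow> v \<in> A \<Longrightarrow> b1 u v \<in> A"
  shows "algebra_isomorphic s2 b2 B s1 b1 A"
proof -
  obtain f where f: "bij_betw f A B"
      "\<And>u v. u\<in>A \<Longrightarrow> v\<in>A \<Longrightarrow> f (u + v) = f u + f v"
      "\<And>c u. u\<in>A \<Longrightarrow> f (s1 c u) = s2 c (f u)"
      "\<And>u v. u\<in>A \<Longrightarrow> v\<in>A \<Longrightarrow> f (b1 u v) = b2 (f u) (f v)"
    using assms(1) unfolding algebra_isomorphic_def by blast
  define g where "g = inv_into A f"
  have g: "g v \<in> A" "f (g v) = v" if "v \<in> B" for v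
    using that f(1) unfolding g_def bij_betw_def
    by (auto simp: inv_into_into f_inv_into_f)
  have gf: "g (f u) = u" if "u \<in> A" for u
    using that f(1) unfolding g_def by (rule bij_betw_inv_into_left[rotated])
  have "bij_betw g B A"
    unfolding g_def using f(1) by (rule bij_betw_inv_into)
  moreover have "g (u + v) = g u + g v" if "u \<in> B" "v \<in> B" for u v
    using gf[OF assms(2)[OF g(1)[OF that(1)] g(1)[OF that(2)]]] f(2) g that by simp
  moreover have "g (s2 c u) = s1 c (g u)" if "u \<in> B" for c u
    using gf[OF assms(3)[OF g(1)[OF that]], of c] f(3) g that by simp
  moreover have "g (b2 u v) = b1 (g u) (g v)" if "u \<in> B" "v \<in> B" for u v
    using gf[OF assms(4)[OF g(1)[OF that(1)] g(1)[OF that(2)]]] f(4) g that by simp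
  ultimately show ?thesis
    unfolding algebra_isomorphic_def by blast
qed

lemma algebra_isomorphic_trans:
  assumes "algebra_isomorphic s1 b1 A s2 b2 B" "algebra_isomorphic s2 b2 B s3 b3 C"
  shows "algebra_isomorphic s1 b1 A s3 b3 C"
proof -
  obtain f where f: "bij_betw f A B"
      "\<forall>u\<in>A. \<forall>v\<in>A. f (u + v) = f u + f v"
      "\<forall>c. \<forall>u\<in>A. f (s1 c u) = s2 c (f u)"
      "\<forall>u\<in>A. \<forall>v\<in>A. f (b1 u v) = b2 (f u) (f v)"
    using assms(1) unfolding algebra_isomorphic_def by blast
  obtain g where g: "bij_betw g B C"
      "\<forall>u\<in>B. \<forall>v\<in>B. g (u + v) = g u + g v"
      "\<forall>c. \<forall>u\<in>B. g (s2 c u) = s3 c (g u)"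
      "\<forall>u\<in>B. \<forall>v\<in>B. g (b2 u v) = b3 (g u) (g v)"
    using assms(2) unfolding algebra_isomorphic_def by blast
  have B: "f u \<in> B" if "u \<in> A" for u
    using f(1) that by (rule bij_betw_apply)
  show ?thesis
    unfolding algebra_isomorphic_def
    using bij_betw_trans[OF f(1) g(1)] f g B by (intro exI[of _ "g \<circ> f"]) simp
qed

section \<open>Algebras given by structure constants\<close>

lemma bracket_of_table_nth:
  "bracket_of_table T u v $ k = (\<Sum>i\<in>UNIV. \<Sum>j\<in>UNIV. u $ i * v $ j * T i j $ k)"
  by (simp add: bracket_of_table_def)

lemma bracket_of_table_linear:
  "Vector_Spaces.linear (*s) (*s) (\<lambda>u. bracket_of_table T u v)"
  "Vector_Spaces.linear (*s) (*s) (\<lambda>v. bracket_of_table T u v)"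
  by (unfold_locales; simp add: bracket_of_table_nth vec_eq_iff algebra_simps
        sum.distrib sum_distrib_left)+

lemma linear_combination_linear:
  fixes b :: "'n::finite \<Rightarrow> 'a::ab_group_add"
  assumes "vector_space smul"
  shows "Vector_Spaces.linear (*s) smul (\<lambda>u :: complex ^ 'n. \<Sum>i\<in>UNIV. smul (u $ i) (b i))"
proof -
  interpret vector_space smul by fact
  show ?thesis
    by unfold_locales (simp_all add: scale_left_distrib sum.distrib scale_sum_right)
qed

text \<open>Both sides are bilinear in \<open>u\<close> and \<open>v\<close>, and the table says that they agree on basis vectors. The vectors \<open>b i\<close>
may be dependent, so this also describes homomorphisms that are not injective.\<close>

lemma linear_combination_bracket:
  fixes b :: "'n::finite \<Rightarrow> 'a::ab_group_add"
  assumes "vector_space smul"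
    and left: "\<And>v. Vector_Spaces.linear smul smul (\<lambda>u. br u v)"
    and right: "\<And>u. Vector_Spaces.linear smul smul (\<lambda>v. br u v)"
    and table: "\<And>i j. br (b i) (b j) = (\<Sum>k\<in>UNIV. smul (T i j $ k) (b k))"
  defines "f \<equiv> \<lambda>u :: complex ^ 'n. \<Sum>i\<in>UNIV. smul (u $ i) (b i)"
  shows "f (bracket_of_table T u v) = br (f u) (f v)"
proof -
  interpret vector_space smul by fact
  interpret f: Vector_Spaces.linear "(*s)" smul f
    unfolding f_def by (rule linear_combination_linear) fact
  interpret l: Vector_Spaces.linear smul smul "\<lambda>u. br u (f v)" by (rule left)
  have "br (f u) (f v) = (\<Sum>i\<in>UNIV. smul (u $ i) (br (b i) (f v)))"
    by (subst (1) f_def) (simp add: l.sum l.scale)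
  also have "\<dots> = (\<Sum>i\<in>UNIV. \<Sum>j\<in>UNIV. smul (u $ i * v $ j) (f (T i j)))"
  proof (rule sum.cong[OF refl])
    fix i
    interpret r: Vector_Spaces.linear smul smul "br (b i)" by (rule right)
    show "smul (u $ i) (br (b i) (f v)) = (\<Sum>j\<in>UNIV. smul (u $ i * v $ j) (f (T i j)))"
      by (simp add: f_def r.sum r.scale table scale_sum_right mult.assoc)
  qed
  also have "\<dots> = f (bracket_of_table T u v)"
    by (simp add: bracket_of_table_def f.sum f.scale)
  finally show ?thesis by simp
qed

lemma bracket_of_table_isomorphic_if_basis:
  fixes b :: "'n::finite \<Rightarrow> 'a::ab_group_add"
  assumes "vector_space smul"
    and "\<And>v. Vector_Spaces.linear smul smul (\<lambda>u. br u v)"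
    and "\<And>u. Vector_Spaces.linear smul smul (\<lambda>v. br u v)"
    and "bij_betw (\<lambda>u :: complex ^ 'n. \<Sum>i\<in>UNIV. smul (u $ i) (b i)) UNIV A"
    and "\<And>i j. br (b i) (b j) = (\<Sum>k\<in>UNIV. smul (T i j $ k) (b k))"
  shows "algebra_isomorphic (*s) (bracket_of_table T) UNIV smul br A"
proof -
  let ?f = "\<lambda>u :: complex ^ 'n. \<Sum>i\<in>UNIV. smul (u $ i) (b i)"
  interpret f: Vector_Spaces.linear "(*s)" smul ?f
    by (rule linear_combination_linear) fact
  show ?thesis
    unfolding algebra_isomorphic_def
    using linear_combination_bracket[where T = T and b = b, OF assms(1-3,5)] assms(4)
    by (intro exI[of _ ?f]) (simp add: f.add f.scale del: vector_add_component vector_smult_component)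
qed

section \<open>Products in coordinates\<close>

text \<open>The normal form used for the nilradicals with one-dimensional square: a bilinear form on the plane
spanned by \<open>e 1\<close> and \<open>e 2\<close>, with values in the line spanned by \<open>e 3\<close>, written in a basis whose
second vector is isotropic. For \<open>\<tau> = 0\<close> the basis consists of two isotropic vectors; the pair
\<open>\<tau> = 1\<close>, \<open>\<beta> = -1\<close> is the form with a single isotropic line, which is the radical of its symmetric part.\<close>

definition plane_form_algebra :: "complex \<Rightarrow> complex \<Rightarrow> complex ^ 3 \<Rightarrow> complex ^ 3 \<Rightarrow> complex ^ 3" where
  "plane_form_algebra \<tau> \<beta> = bracket_of_table (\<lambda>i j.
     if (i, j) = (1, 1) then \<tau> *s e 3
     else if (i, j) = (1, 2) then \<beta> *s e 3
     else if (i, j) = (2, 1) then e 3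
     else 0)"

lemma e_nth: "e i $ j = (if j = i then 1 else 0)"
  by (simp add: e_def axis_def)

lemma R1_nth:
  "R1 \<beta> u v $ 0 = 0"
  "R1 \<beta> u v $ 1 = u $ 1 * v $ 0 - u $ 0 * v $ 1"
  "R1 \<beta> u v $ 2 = \<beta> * (u $ 2 * v $ 0 - u $ 0 * v $ 2)"
  "R1 \<beta> u v $ 3 = u $ 2 * v $ 1 + \<beta> * (u $ 1 * v $ 2) + (\<beta> + 1) * (u $ 3 * v $ 0)"
  by (simp_all add: R1_def bracket_of_table_nth sum4 e_nth algebra_simps)

lemma R3_nth:
  "R3 u v $ 0 = 0"
  "R3 u v $ 1 = u $ 1 * v $ 0 - u $ 0 * v $ 1"
  "R3 u v $ 2 = u $ 1 * v $ 1 + 2 * (u $ 2 * v $ 0)"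
  "R3 u v $ 3 = u $ 2 * v $ 1 + 3 * (u $ 3 * v $ 0)"
  by (simp_all add: R3_def bracket_of_table_nth sum4 e_nth algebra_simps)

lemma R2_eq_R1: "R2 = R1 1"
  unfolding R2_def R1_def by (rule arg_cong[where f = bracket_of_table]) (auto simp: fun_eq_iff)

lemma plane_form_algebra_nth:
  "plane_form_algebra \<tau> \<beta> u v $ 1 = 0"
  "plane_form_algebra \<tau> \<beta> u v $ 2 = 0"
  "plane_form_algebra \<tau> \<beta> u v $ 3 = \<tau> * (u $ 1 * v $ 1) + \<beta> * (u $ 1 * v $ 2) + u $ 2 * v $ 1"
  by (simp_all add: plane_form_algebra_def bracket_of_table_nth sum_3 e_nth algebra_simps)

lemma lambda4_nth:
  "lambda4 \<alpha> u v $ 1 = 0"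
  "lambda4 \<alpha> u v $ 2 = 0"
  "lambda4 \<alpha> u v $ 3 = u $ 1 * v $ 1 + u $ 1 * v $ 2 + \<alpha> * (u $ 2 * v $ 2)"
  by (simp_all add: lambda4_def bracket_of_table_nth sum_3 e_nth algebra_simps)

lemma lambda5_eq: "lambda5 = plane_form_algebra 0 1"
  unfolding lambda5_def plane_form_algebra_def
  by (rule arg_cong[where f = bracket_of_table]) (auto simp: fun_eq_iff)

section \<open>The three families are solvable with the required nilradical\<close>

lemma leibniz_algebra_bracket_of_table:
  assumes "\<And>x y z. bracket_of_table T x (bracket_of_table T y z) =
    bracket_of_table T (bracket_of_table T x y) z - bracket_of_table T (bracket_of_table T x z) y"
  shows "leibniz_algebra (*s) (bracket_of_table T)"
  by (intro leibniz_algebra.intro leibniz_algebra_axioms.intro vec.vector_space_axioms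
      bracket_of_table_linear assms)

lemma leibniz_R1: "leibniz_algebra (*s) (R1 \<beta>)"
  unfolding R1_def
  by (intro leibniz_algebra_bracket_of_table, fold R1_def)
    (simp add: vec_eq_iff all4 R1_nth algebra_simps)

lemma leibniz_R3: "leibniz_algebra (*s) R3"
  unfolding R3_def
  by (intro leibniz_algebra_bracket_of_table, fold R3_def)
    (simp add: vec_eq_iff all4 R3_nth algebra_simps)

text \<open>The coordinates \<open>0\<close> and \<open>1\<close> of the product decide the maximality of the hyperplane \<open>u $ 0 = 0\<close>. If an
ideal contains \<open>y\<close> with \<open>y $ 0 \<noteq> 0\<close>, then right multiplication by \<open>y\<close> scales the coordinate \<open>1\<close> of the vectors
in the hyperplane by \<open>y $ 0\<close>. A vector with nonzero coordinate \<open>1\<close> thus survives in every term of the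
lower central series. The last two assumptions say that products with the hyperplane go down
in the flag of coordinate subspaces.\<close>

lemma nilradical_of_extension:
  fixes B :: "complex ^ 4 \<Rightarrow> complex ^ 4 \<Rightarrow> complex ^ 4"
  assumes "leibniz_algebra (*s) B"
    and nth0: "\<And>u v. B u v $ 0 = 0"
    and nth1: "\<And>u v. B u v $ 1 = u $ 1 * v $ 0 - u $ 0 * v $ 1"
    and nth2: "\<And>u v. u $ 0 = 0 \<Longrightarrow> u $ 1 = 0 \<Longrightarrow> v $ 0 = 0 \<Longrightarrow> B u v $ 2 = 0"
    and nth3: "\<And>u v. u $ 0 = 0 \<Longrightarrow> u $ 1 = 0 \<Longrightarrow> u $ 2 = 0 \<Longrightarrow> v $ 0 = 0 \<Longrightarrow> B u v $ 3 = 0"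
  shows "leibniz_algebra.is_nilradical (*s) B {u. u $ 0 = 0}"
    and "leibniz_algebra.solvable (*s) B UNIV"
proof -
  interpret leibniz_algebra "(*s)" B by fact
  let ?N = "{u :: complex ^ 4. u $ 0 = 0}"
  have nil: "nilpotent ?N"
  proof (rule nilpotent_if_coordinates_lowered[where d = 4 and c = "\<lambda>k u. u $ of_nat k"])
    show "u = 0" if "\<And>k. k < 4 \<Longrightarrow> u $ of_nat k = 0" for u :: "complex ^ 4"
      using that[of 0] that[of 1] that[of 2] that[of 3] by (simp add: vec_eq_iff all4)
    show "B u v $ of_nat k = 0"
      if "v \<in> ?N" "k < 4" and z: "\<And>i. i < k \<Longrightarrow> u $ of_nat i = 0" for u v and k :: nat
    proof -
      have "k = 0 \<or> k = 1 \<or> k = 2 \<or> k = 3" using \<open>k < 4\<close> by linarith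
      then show ?thesis
        using \<open>v \<in> ?N\<close> z[of 0] z[of 1] z[of 2] nth0 nth1 nth2 nth3 by auto
    qed
  qed simp_all
  have ideal: "is_ideal ?N"
    by (simp add: is_ideal_def vec.subspace_def nth0)
  have "I \<subseteq> ?N" if I: "is_ideal I" "nilpotent I" for I
  proof (rule ccontr)
    assume "\<not> I \<subseteq> ?N"
    then obtain y where y: "y \<in> I" "y $ 0 \<noteq> 0" by auto
    have "\<exists>u \<in> lower_central_series I k. u $ 0 = 0 \<and> u $ 1 \<noteq> 0" for k
    proof (induction k)
      case 0
      have "B (e 1) y \<in> I" using I y by (auto simp: is_ideal_def)
      then show ?case using y by (intro bexI[of _ "B (e 1) y"]) (simp_all add: nth0 nth1 e_nth)
    next
      case (Suc k)
      then obtain u where u: "u \<in> lower_central_series I k" "u $ 0 = 0" "u $ 1 \<noteq> 0" by blast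
      then have "B u y \<in> lower_central_series I (Suc k)"
        using y unfolding lower_central_series.simps product_def by (intro vec.span_base) blast
      then show ?case using u y by (intro bexI[of _ "B u y"]) (simp_all add: nth0 nth1)
    qed
    moreover obtain k where k: "lower_central_series I k = {0}"
      using I(2) by (auto simp: nilpotent_def)
    ultimately have "\<exists>u \<in> lower_central_series I k. u $ 0 = 0 \<and> u $ 1 \<noteq> 0" by blast
    then show False by (simp add: k)
  qed
  then show "is_nilradical ?N"
    using nil ideal by (simp add: is_nilradical_def)
  have "product UNIV UNIV \<subseteq> ?N"
    unfolding product_def using ideal by (intro vec.span_minimal) (auto simp: nth0 is_ideal_def)
  then show "solvable UNIV"
    using nil by (rule solvable_if_product_in_nilpotent)
qed

section \<open>Normal forms of the nilradicals\<close>

lemma linear_injective_bij: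
  fixes f :: "complex ^ 'n::finite \<Rightarrow> complex ^ 'n"
  assumes "Vector_Spaces.linear (*s) (*s) f" "\<And>u. f u = 0 \<Longrightarrow> u = 0"
  shows "bij f"
proof -
  have "inj f"
    using assms vec.linear_inj_iff_eq_0 by blast
  with assms(1) show ?thesis
    using vec.linear_inj_imp_surj by (auto simp: bij_def)
qed

text \<open>The algebra with structure constants \<open>T'\<close> is the algebra with structure constants \<open>T\<close>, written in the
basis \<open>b\<close>. All explicit isomorphisms below come from this lemma.\<close>

lemma change_of_basis:
  fixes b :: "'n::finite \<Rightarrow> complex ^ 'n"
  assumes indep: "\<And>u. (\<Sum>i\<in>UNIV. u $ i *s b i) = 0 \<Longrightarrow> u = 0"
    and table: "\<And>i j. bracket_of_table T (b i) (b j) = (\<Sum>k\<in>UNIV. T' i j $ k *s b k)"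
  shows "algebra_isomorphic (*s) (bracket_of_table T') UNIV (*s) (bracket_of_table T) UNIV"
proof (rule bracket_of_table_isomorphic_if_basis[OF vec.vector_space_axioms bracket_of_table_linear _ table])
  show "bij (\<lambda>u :: complex ^ 'n. \<Sum>i\<in>UNIV. u $ i *s b i)"
    by (rule linear_injective_bij)
      (unfold_locales, simp_all add: indep vec.scale_left_distrib sum.distrib vec.scale_sum_right)
qed

text \<open>A combination of \<open>e 1\<close> and \<open>e 2\<close> with coordinates \<open>(a, c)\<close> has square zero in \<open>lambda4 \<alpha>\<close> iff
$a^2 + ac + \alpha c^2 = 0$. This quadratic form has discriminant $s^2 = 1 - 4\alpha$, so for
\<open>s \<noteq> 0\<close> it has two isotropic lines, spanned by the vectors with $c = 1$ and $a = (\pm s - 1)/2$. These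
vectors have products $s(1-s)/2$ and $-s(1+s)/2$ in the two orders, and $\beta$ is the ratio of the products.\<close>

lemma plane_form_isomorphic_lambda4:
  assumes \<alpha>: "\<alpha> = (1 - s\<^sup>2) / 4" and "s \<noteq> 0" "s \<noteq> -1"
  shows "algebra_isomorphic (*s) (plane_form_algebra 0 ((s - 1) / (s + 1))) UNIV (*s) (lambda4 \<alpha>) UNIV"
proof -
  have s1: "s + 1 \<noteq> 0" using assms(3) by (metis add_eq_0_iff2)
  define b :: "3 \<Rightarrow> complex ^ 3" where "b i =
    (if i = 1 then ((s - 1) / 2) *s e 1 + e 2
     else if i = 2 then (- (s + 1) / 2) *s e 1 + e 2
     else (- s * (s + 1) / 2) *s e 3)" for i
  have b: "b 1 = ((s - 1) / 2) *s e 1 + e 2" "b 2 = (- (s + 1) / 2) *s e 1 + e 2"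
      "b 3 = (- s * (s + 1) / 2) *s e 3"
    by (simp_all add: b_def)
  show ?thesis
    unfolding plane_form_algebra_def lambda4_def
  proof (rule change_of_basis[where b = b], fold lambda4_def)
    fix u :: "complex ^ 3"
    assume z: "(\<Sum>i\<in>UNIV. u $ i *s b i) = 0"
    have *: "(s - 1) * u $ 1 = (s + 1) * u $ 2" "u $ 2 = - u $ 1"
      using arg_cong[OF z, of "\<lambda>w. w $ 1"] arg_cong[OF z, of "\<lambda>w. w $ 2"]
      by (simp_all add: sum_3 b e_nth field_simps add_eq_0_iff2)
    have "u $ 3 = 0"
      using arg_cong[OF z, of "\<lambda>w. w $ 3"] \<open>s \<noteq> 0\<close> s1
      by (simp add: sum_3 b e_nth add_eq_0_iff2)
    from * have "s * u $ 1 = 0" by (simp add: algebra_simps)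
    then show "u = 0" using * \<open>u $ 3 = 0\<close> \<open>s \<noteq> 0\<close> by (simp add: vec_eq_iff forall_3)
  next
    fix i j :: 3
    show "lambda4 \<alpha> (b i) (b j) =
       (\<Sum>k\<in>UNIV. (if (i, j) = (1, 1) then 0 *s e 3
       else if (i, j) = (1, 2) then ((s - 1) / (s + 1)) *s e 3
       else if (i, j) = (2, 1) then e 3
       else 0) $ k *s b k)"
      using exhaust_3[of i] exhaust_3[of j] s1
      by (elim disjE; simp add: vec_eq_iff forall_3 sum_3 lambda4_nth e_nth \<alpha> b;
         simp add: field_simps power2_eq_square)
  qed
qed

text \<open>For \<open>\<alpha> = 1 / 4\<close> the two isotropic lines coincide: both are spanned by \<open>e 1 - 2 *s e 2\<close>.\<close>

lemma plane_form_isomorphic_lambda4_quarter: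
  "algebra_isomorphic (*s) (plane_form_algebra 1 (- 1)) UNIV (*s) (lambda4 (1 / 4)) UNIV"
proof -
  define b :: "3 \<Rightarrow> complex ^ 3" where "b i =
    (if i = 1 then e 1 else if i = 2 then e 1 - 2 *s e 2 else e 3)" for i
  have b: "b 1 = e 1" "b 2 = e 1 - 2 *s e 2" "b 3 = e 3"
    by (simp_all add: b_def)
  show ?thesis
    unfolding plane_form_algebra_def lambda4_def
  proof (rule change_of_basis[where b = b], fold lambda4_def)
    fix u :: "complex ^ 3"
    assume z: "(\<Sum>i\<in>UNIV. u $ i *s b i) = 0"
    then show "u = 0"
      by (auto simp: vec_eq_iff forall_3 sum_3 b e_nth)
  next
    fix i j :: 3
    show "lambda4 (1 / 4) (b i) (b j) =
       (\<Sum>k\<in>UNIV. (if (i, j) = (1, 1) then 1 *s e 3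
       else if (i, j) = (1, 2) then (- 1) *s e 3
       else if (i, j) = (2, 1) then e 3
       else 0) $ k *s b k)"
      using exhaust_3[of i] exhaust_3[of j]
      by (elim disjE; simp add: vec_eq_iff forall_3 sum_3 lambda4_nth e_nth b)
  qed
qed

text \<open>The map from \<open>\<alpha>\<close> to \<open>\<beta>\<close> is inverted by $\alpha = -\beta/(1-\beta)^2$. This expression does not change
when $\beta$ is replaced by $1/\beta$, so it determines \<open>\<alpha>\<close> from the unordered pair of \<open>\<beta>\<close> and its inverse.
The principal square root has nonnegative real part, so the denominator \<open>s + 1\<close> is nonzero.\<close>

lemma beta_properties:
  assumes "\<alpha> \<noteq> 0" "\<alpha> \<noteq> 1 / 4"
  shows "beta \<alpha> \<noteq> 0" "beta \<alpha> \<noteq> -1" "beta \<alpha> \<noteq> 1" "\<alpha> = - beta \<alpha> / (1 - beta \<alpha>)\<^sup>2"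
    and "algebra_isomorphic (*s) (plane_form_algebra 0 (beta \<alpha>)) UNIV (*s) (lambda4 \<alpha>) UNIV"
proof -
  define s where "s = csqrt (1 - 4 * \<alpha>)"
  have "s\<^sup>2 = 1 - 4 * \<alpha>" by (simp add: s_def)
  then have \<alpha>: "\<alpha> = (1 - s\<^sup>2) / 4" by simp
  have s: "s \<noteq> 0" "s \<noteq> 1"
    using assms by (auto simp: \<alpha>)
  have "s \<noteq> -1"
    using csqrt_principal[of "1 - 4 * \<alpha>"] unfolding s_def[symmetric] by auto
  then have s1: "s + 1 \<noteq> 0" by (metis add_eq_0_iff2)
  have \<beta>: "beta \<alpha> = (s - 1) / (s + 1)"
    by (simp add: beta_def s_def)
  show "beta \<alpha> \<noteq> 0" "beta \<alpha> \<noteq> -1" "beta \<alpha> \<noteq> 1"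
    using s s1 by (auto simp: \<beta> field_simps)
  have "1 - beta \<alpha> = 2 / (s + 1)"
    using s1 by (simp add: \<beta> field_simps)
  then have "- beta \<alpha> / (1 - beta \<alpha>)\<^sup>2 = - ((s - 1) / (s + 1)) / (2 / (s + 1))\<^sup>2"
    by (simp add: \<beta>)
  also have "\<dots> = \<alpha>"
    using s1 by (simp add: \<alpha> divide_simps power2_eq_square) (simp add: algebra_simps)
  finally show "\<alpha> = - beta \<alpha> / (1 - beta \<alpha>)\<^sup>2" by simp
  show "algebra_isomorphic (*s) (plane_form_algebra 0 (beta \<alpha>)) UNIV (*s) (lambda4 \<alpha>) UNIV"
    unfolding \<beta> using \<alpha> s(1) \<open>s \<noteq> -1\<close> by (rule plane_form_isomorphic_lambda4)
qed

section \<open>The nilradicals of the three families\<close>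

text \<open>The embedding of the index type \<open>3\<close> into the standard basis of the hyperplane \<open>u $ 0 = 0\<close>.\<close>

definition nil_basis :: "3 \<Rightarrow> complex ^ 4" where
  "nil_basis i = (if i = 1 then e 1 else if i = 2 then e 2 else e 3)"

lemma nil_basis_simps: "nil_basis 1 = e 1" "nil_basis 2 = e 2" "nil_basis 3 = e 3"
  by (simp_all add: nil_basis_def)

lemma nilradical_isomorphic:
  fixes T :: "3 \<Rightarrow> 3 \<Rightarrow> complex ^ 3"
  assumes B: "leibniz_algebra (*s) B"
    and table: "\<And>i j. B (nil_basis i) (nil_basis j) = (\<Sum>k\<in>UNIV. T i j $ k *s nil_basis k)"
  shows "algebra_isomorphic (*s) (bracket_of_table T) UNIV (*s) B {u :: complex ^ 4. u $ 0 = 0}"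
proof -
  interpret leibniz_algebra "(*s)" B by fact
  show ?thesis
  proof (rule bracket_of_table_isomorphic_if_basis[OF vec.vector_space_axioms linear_bracket_left
        linear_bracket_right _ table])
    have f: "(\<Sum>i\<in>UNIV. u $ i *s nil_basis i) = u $ 1 *s e 1 + u $ 2 *s e 2 + u $ 3 *s e 3" for u :: "complex ^ 3"
      by (simp add: sum_3 nil_basis_simps)
    show "bij_betw (\<lambda>u :: complex ^ 3. \<Sum>i\<in>UNIV. u $ i *s nil_basis i) UNIV {u. u $ 0 = 0}"
      unfolding f
      by (rule bij_betw_byWitness[where f' = "\<lambda>w. vector [w $ 1, w $ 2, w $ 3]"])
        (auto simp: vec_eq_iff forall_3 all4 e_nth vector_3)
  qed
qed

lemma nilradical_R1:
  "algebra_isomorphic (*s) (R1 \<beta>) {u. u $ 0 = 0} (*s) (plane_form_algebra 0 \<beta>) UNIV"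
proof (rule algebra_isomorphic_sym)
  have "\<forall>i j. R1 \<beta> (nil_basis i)
      (nil_basis j) =
     (\<Sum>k\<in>UNIV. (if (i, j) = (1, 1) then 0 *s e 3
     else if (i, j) = (1, 2) then \<beta> *s e 3
     else if (i, j) = (2, 1) then e 3
     else 0) $ k *s (nil_basis k))"
    by (simp add: forall_3 nil_basis_simps vec_eq_iff all4 R1_nth sum_3 e_nth)
  then show "algebra_isomorphic (*s) (plane_form_algebra 0 \<beta>) UNIV (*s) (R1 \<beta>) {u. u $ 0 = 0}"
    unfolding plane_form_algebra_def by (intro nilradical_isomorphic leibniz_R1) blast
qed simp_all

lemma nilradical_R3:
  "algebra_isomorphic (*s) R3 {u. u $ 0 = 0} (*s) lambda6 UNIV"
proof (rule algebra_isomorphic_sym)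
  have "\<forall>i j. R3 (nil_basis i)
      (nil_basis j) =
     (\<Sum>k\<in>UNIV. (if (i, j) = (1, 1) then e 2
     else if (i, j) = (2, 1) then e 3
     else 0) $ k *s (nil_basis k))"
    by (simp add: forall_3 nil_basis_simps vec_eq_iff all4 R3_nth sum_3 e_nth)
  then show "algebra_isomorphic (*s) lambda6 UNIV (*s) R3 {u. u $ 0 = 0}"
    unfolding lambda6_def by (intro nilradical_isomorphic leibniz_R3) blast
qed simp_all

lemma dim_complex_4: "vec.dim (UNIV :: (complex ^ 4) set) = 4"
  unfolding vec_dim_card by simp

lemma solvable_4_R1:
  assumes "is_rigid_nilpotent_3 (*s) (R1 \<beta>) {u. u $ 0 = 0}"
  shows "solvable_4_rigid_nilradical_3 (*s) (R1 \<beta>)"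
  using nilradical_of_extension[OF leibniz_R1[of \<beta>]] leibniz_R1[of \<beta>] assms
  unfolding solvable_4_rigid_nilradical_3_def by (auto simp: R1_nth dim_complex_4 simp del: vec.dim_UNIV)

lemma solvable_4_R1_beta:
  assumes "\<alpha> \<noteq> 0" "\<alpha> \<noteq> 1 / 4"
  shows "solvable_4_rigid_nilradical_3 (*s) (R1 (beta \<alpha>))"
  using algebra_isomorphic_trans[OF nilradical_R1 beta_properties(5)[OF assms]] assms
  by (intro solvable_4_R1) (auto simp: is_rigid_nilpotent_3_def)

lemma solvable_4_R2: "solvable_4_rigid_nilradical_3 (*s) R2"
  using nilradical_R1[of 1] unfolding R2_eq_R1
  by (intro solvable_4_R1) (auto simp: is_rigid_nilpotent_3_def lambda5_eq)

lemma solvable_4_R3: "solvable_4_rigid_nilradical_3 (*s) R3"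
  using nilradical_of_extension[OF leibniz_R3] leibniz_R3 nilradical_R3
  unfolding solvable_4_rigid_nilradical_3_def is_rigid_nilpotent_3_def
  by (auto simp: R3_nth dim_complex_4 simp del: vec.dim_UNIV)

section \<open>The three families are pairwise non-isomorphic\<close>

text \<open>Eigenvalues of right multiplications do not suffice here: for \<open>\<beta> = 1 / 2\<close> those of \<open>R1 \<beta>\<close> are
proportional to those of \<open>R3\<close>. The algebras differ by an identity: products lie in the hyperplane \<open>u $ 0 = 0\<close>,
where every product of three factors vanishes in \<open>R1 \<beta>\<close>, whereas in \<open>R3\<close> the vector \<open>e 1\<close> is a product
and its left-normed cube is \<open>e 3\<close>.\<close>

lemma R1_not_isomorphic_R3:
  "\<not> algebra_isomorphic (*s) (R1 \<beta>) UNIV (*s) R3 UNIV"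
proof
  assume "algebra_isomorphic (*s) (R1 \<beta>) UNIV (*s) R3 UNIV"
  then obtain f where f: "bij f" "\<And>u v. f (u + v) = f u + f v"
      "\<And>u v. f (R1 \<beta> u v) = R3 (f u) (f v)"
    unfolding algebra_isomorphic_def by auto
  have f0: "f 0 = 0" using f(2)[of 0 0] by simp
  let ?x = "inv f (e 0)" and ?y = "inv f (e 1)"
  have "R1 \<beta> (R1 \<beta> (R1 \<beta> ?y ?x) (R1 \<beta> ?y ?x)) (R1 \<beta> ?y ?x) = 0"
    by (simp add: vec_eq_iff all4 R1_nth)
  from arg_cong[OF this, of f]
  have "R3 (R3 (R3 (e 1) (e 0)) (R3 (e 1) (e 0))) (R3 (e 1) (e 0)) = 0"
    using f(1) by (simp add: f(3) f0 bij_is_surj surj_f_inv_f)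
  then have "R3 (R3 (R3 (e 1) (e 0)) (R3 (e 1) (e 0))) (R3 (e 1) (e 0)) $ 3 = 0"
    by simp
  then show False by (simp add: R3_nth e_nth)
qed

text \<open>The images of \<open>e 1\<close> and \<open>e 2\<close> are eigenvectors, for the eigenvalues \<open>1\<close> and \<open>\<beta>\<close>, of right
multiplication by the image of \<open>e 0\<close>. Modulo \<open>e 3\<close> this operator has eigenvalues \<open>c\<close> and \<open>c * \<gamma>\<close> on the hyperplane,
where \<open>c\<close> is the coordinate \<open>0\<close> of that image. The eigenvalues match up in one of two orders, which gives \<open>c = 1\<close> or
\<open>c = \<beta>\<close>. That the product of the two images is nonzero makes one of the two matchings total.\<close>

lemma R1_isomorphic_R1_imp:
  assumes "algebra_isomorphic (*s) (R1 \<beta>) UNIV (*s) (R1 \<gamma>) UNIV" and "\<beta> \<noteq> 0"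
  shows "\<gamma> = \<beta> \<or> \<beta> * \<gamma> = 1"
proof -
  obtain f where f: "bij f" "\<And>u v. f (u + v) = f u + f v" "\<And>c u. f (c *s u) = c *s f u"
      "\<And>u v. f (R1 \<beta> u v) = R1 \<gamma> (f u) (f v)"
    using assms(1) unfolding algebra_isomorphic_def by auto
  have f0: "f 0 = 0" using f(2)[of 0 0] by simp
  define x a b where "x = f (e 0)" and "a = f (e 1)" and "b = f (e 2)"
  have *: "R1 \<beta> (e 1) (e 0) = e 1" "R1 \<beta> (e 2) (e 0) = \<beta> *s e 2" "R1 \<beta> (e 2) (e 1) = e 3"
    by (simp_all add: vec_eq_iff all4 R1_nth e_nth)
  have a: "R1 \<gamma> a x = a" and b: "R1 \<gamma> b x = \<beta> *s b" and ba: "R1 \<gamma> b a = f (e 3)"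
    unfolding x_def a_def b_def by (simp_all flip: f(3,4) add: *)
  have "e 3 \<noteq> (0 :: complex ^ 4)" by (simp add: e_nth vec_eq_iff)
  then have "R1 \<gamma> b a \<noteq> 0"
    unfolding ba using f(1) f0 by (metis bij_pointE)
  moreover have a0: "a $ 0 = 0"
    using a by (metis R1_nth(1))
  moreover have b0: "b $ 0 = 0"
    using arg_cong[OF b, of "\<lambda>w. w $ 0"] \<open>\<beta> \<noteq> 0\<close> by (simp add: R1_nth)
  ultimately have "b $ 2 * a $ 1 + \<gamma> * (b $ 1 * a $ 2) \<noteq> 0"
    by (auto simp: vec_eq_iff all4 R1_nth)
  then consider "b $ 2 \<noteq> 0" "a $ 1 \<noteq> 0" | "b $ 1 \<noteq> 0" "a $ 2 \<noteq> 0" by fastforce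
  then show ?thesis
  proof cases
    case 1
    have "x $ 0 = 1"
      using arg_cong[OF a, of "\<lambda>w. w $ 1"] a0 1 by (simp add: R1_nth)
    then show ?thesis
      using arg_cong[OF b, of "\<lambda>w. w $ 2"] b0 1 by (simp add: R1_nth)
  next
    case 2
    have "x $ 0 = \<beta>"
      using arg_cong[OF b, of "\<lambda>w. w $ 1"] b0 2 by (simp add: R1_nth)
    then show ?thesis
      using arg_cong[OF a, of "\<lambda>w. w $ 2"] a0 2 by (simp add: R1_nth algebra_simps)
  qed
qed

section \<open>One-dimensional extensions of the nilradicals\<close>

text \<open>Every right multiplication moves each term of the flag $\langle e_0, e_1, e_2, e_3\rangle \supset
\langle e_1, e_2, e_3\rangle \supset \langle e_2, e_3\rangle \supset \langle e_3\rangle \supset 0$ into the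
next one. The table then defines a nilpotent algebra.\<close>

definition strictly_triangular :: "(4 \<Rightarrow> 4 \<Rightarrow> complex ^ 4) \<Rightarrow> bool" where
  "strictly_triangular T \<longleftrightarrow>
     (\<forall>j. (\<forall>i. T i j $ 0 = 0) \<and> (\<forall>i. i \<noteq> 0 \<longrightarrow> T i j $ 1 = 0) \<and>
          T 2 j $ 2 = 0 \<and> T 3 j $ 2 = 0 \<and> T 3 j $ 3 = 0)"

lemma bracket_of_table_e_left:
  "bracket_of_table T (e i) u $ m = (\<Sum>l\<in>UNIV. u $ l * T i l $ m)"
proof -
  have "(\<Sum>l\<in>UNIV. e i $ k * u $ l * T k l $ m) = (if k = i then \<Sum>l\<in>UNIV. u $ l * T k l $ m else 0)" for k
    by (simp add: e_nth)
  then show ?thesis by (simp add: bracket_of_table_nth)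
qed

lemma bracket_of_table_e_right:
  "bracket_of_table T u (e i) $ m = (\<Sum>l\<in>UNIV. u $ l * T l i $ m)"
proof -
  have "(\<Sum>l\<in>UNIV. u $ k * e i $ l * T k l $ m) = u $ k * T k i $ m" for k
  proof -
    have "u $ k * e i $ l * T k l $ m = (if l = i then u $ k * T k l $ m else 0)" for l
      by (simp add: e_nth)
    then show ?thesis by simp
  qed
  then show ?thesis by (simp add: bracket_of_table_nth)
qed

lemma bracket_of_table_e: "bracket_of_table T (e i) (e j) = T i j"
proof -
  have "e j $ l * T i l $ m = (if l = j then T i l $ m else 0)" for l m
    by (simp add: e_nth)
  then show ?thesis by (simp add: vec_eq_iff bracket_of_table_e_left)
qed

text \<open>The Leibniz identity for three basis vectors, in coordinates. In the following two proofs an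
instance for the indices \<open>i j k m\<close> is the coordinate \<open>m\<close> of the identity for \<open>e i\<close>, \<open>e j\<close>, \<open>e k\<close>.\<close>

lemma leibniz_structure_constants:
  fixes T :: "'n::finite \<Rightarrow> 'n \<Rightarrow> complex ^ 'n"
  assumes "\<And>x y z. bracket_of_table T x (bracket_of_table T y z) =
    bracket_of_table T (bracket_of_table T x y) z - bracket_of_table T (bracket_of_table T x z) y"
  shows "(\<Sum>l\<in>UNIV. T i j $ l * T l k $ m) - (\<Sum>l\<in>UNIV. T i k $ l * T l j $ m) =
    (\<Sum>l\<in>UNIV. T j k $ l * T i l $ m)"
  using arg_cong[OF assms[of "e i" "e j" "e k"], of "\<lambda>w. w $ m"]
  by (simp add: bracket_of_table_e bracket_of_table_e_left bracket_of_table_e_right)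

text \<open>Write \<open>x\<close> for \<open>e 0\<close>, $A$ for the bilinear form on the plane, and $D$ for the operator that right
multiplication by \<open>x\<close> induces on the plane. The Leibniz identity gives two conditions. Right
multiplication is a derivation, so $A(Du,v) + A(u,Dv) = \lambda A(u,v)$ with $[e_3,x] = \lambda e_3$.
Every $[u,v]+[v,u]$ annihilates the algebra from the right, so $[x,e_3] = 0$ and left multiplication by \<open>x\<close> induces
$-D$; the identity for $[x,[u,v]]$ then says that $A(Du,v)$ is symmetric in $u$ and $v$. Together they
give $2SD = \lambda A$ for the symmetric part $S$ of $A$ (as matrices). If $S$ is degenerate
(\<open>\<tau> = 1\<close>, \<open>\<beta> = -1\<close>), then $\lambda = 0$, because $A$ is nondegenerate, and $D$ is nilpotent. If \<open>\<tau> = 0\<close>, then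
$D$ is $a$ times the diagonal matrix with entries $1$ and \<open>\<beta>\<close>. For \<open>a \<noteq> 0\<close> the terms of the products with \<open>x\<close>
in the direction of \<open>e 3\<close> are removed by a change of basis.\<close>

lemma plane_form_extension:
  fixes T :: "4 \<Rightarrow> 4 \<Rightarrow> complex ^ 4"
  assumes leibniz: "\<And>x y z. bracket_of_table T x (bracket_of_table T y z) =
    bracket_of_table T (bracket_of_table T x y) z - bracket_of_table T (bracket_of_table T x z) y"
    and ideal: "\<And>i. i \<noteq> 0 \<Longrightarrow> T i 0 $ 0 = 0" "\<And>i. i \<noteq> 0 \<Longrightarrow> T 0 i $ 0 = 0"
    and table: "T 1 1 = \<tau> *s e 3" "T 1 2 = \<beta> *s e 3" "T 1 3 = 0"
       "T 2 1 = e 3" "T 2 2 = 0" "T 2 3 = 0" "T 3 1 = 0" "T 3 2 = 0" "T 3 3 = 0"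
    and cases: "\<tau> = 0 \<and> \<beta> \<noteq> 0 \<and> \<beta> \<noteq> -1 \<or> \<tau> = 1 \<and> \<beta> = -1"
  shows "strictly_triangular T \<or>
    \<tau> = 0 \<and> algebra_isomorphic (*s) (R1 \<beta>) UNIV (*s) (bracket_of_table T) UNIV"
proof -
  have \<beta>: "\<beta> \<noteq> 0" using cases by auto
  define a p c q l z3 where "a = T 1 0 $ 1" and "p = T 1 0 $ 3"
    and "c = T 2 0 $ 1" and "q = T 2 0 $ 3" and "l = T 3 0 $ 3" and "z3 = T 0 0 $ 3"
  note sc = leibniz_structure_constants[OF leibniz, unfolded sum4]
  have e3: "e 3 $ (0::4) = 0" "e 3 $ (1::4) = 0" "e 3 $ (2::4) = 0" "e 3 $ (3::4) = 1"
    by (simp_all add: e_nth)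
  have N: "T 1 0 $ 0 = 0" "T 2 0 $ 0 = 0" "T 3 0 $ 0 = 0" "T 0 1 $ 0 = 0" "T 0 2 $ 0 = 0" "T 0 3 $ 0 = 0"
    by (simp_all add: ideal)
  note s = N table e3
  \<comment> \<open>The identity for \<open>x\<close>, \<open>x\<close>, \<open>x\<close> reads \<open>[x, [x, x]] = 0\<close>; its coordinate \<open>0\<close> is a square.\<close>
  have "T 0 0 $ 0 = 0" using sc[of 0 0 0 0] by (simp add: s)
  note s = this s
  have T30: "T 3 0 $ 1 = 0" "T 3 0 $ 2 = 0"
    using sc[of 2 1 0 1] sc[of 2 1 0 2] by (simp_all add: s)
  note s = this s
  have T03_12: "T 0 3 $ 1 = 0" "T 0 3 $ 2 = 0"
    using sc[of 0 2 1 1] sc[of 0 2 1 2] by (simp_all add: s)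
  note s = this s
  \<comment> \<open>The vector \<open>e 3\<close> annihilates from the right, being proportional to the symmetric product of \<open>e 1\<close> with \<open>e 2\<close>
    if \<open>\<beta> \<noteq> -1\<close>, and to the square of \<open>e 1\<close> if \<open>\<tau> = 1\<close>.\<close>
  have T03: "T 0 3 $ 3 = 0"
  proof -
    have "\<tau> * T 0 3 $ 3 = 0" using sc[of 0 1 1 3] by (simp add: s)
    moreover have A: "\<beta> * T 0 3 $ 3 = T 0 1 $ 1 * \<beta> - (T 0 2 $ 1 * \<tau> + T 0 2 $ 2)"
      using sc[of 0 1 2 3] by (simp add: s)
    have B: "T 0 3 $ 3 = (T 0 2 $ 1 * \<tau> + T 0 2 $ 2) - T 0 1 $ 1 * \<beta>"
      using sc[of 0 2 1 3] by (simp add: s)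
    have "\<beta> * T 0 3 $ 3 + T 0 3 $ 3 = 0"
      unfolding A using B by (metis add.right_inverse add.commute minus_diff_eq)
    then have "(\<beta> + 1) * T 0 3 $ 3 = 0" by (simp add: algebra_simps)
    ultimately show ?thesis using cases by (auto simp: add_eq_0_iff2)
  qed
  note s = this s
  note s0 = s
  define b d where "b = T 1 0 $ 2" and "d = T 2 0 $ 2"
  note names = a_def b_def p_def c_def d_def q_def l_def z3_def
  have l: "l = a + \<tau> * c + d"
    using sc[of 2 1 0 3] by (simp add: s names algebra_simps)
  have e201: "\<tau> * c + d - l = T 0 1 $ 1"
    using sc[of 2 0 1 3] by (simp add: s names algebra_simps)
  have e110: "\<tau> * l = 2 * (\<tau> * a) + b * (1 + \<beta>)"
    using sc[of 1 1 0 3] by (simp add: s names algebra_simps)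
  have e101: "\<tau> * a + b - \<tau> * l = \<tau> * T 0 1 $ 1 + \<beta> * T 0 1 $ 2"
    using sc[of 1 0 1 3] by (simp add: s names algebra_simps)
  have "- (\<beta> * c) = c"
    using sc[of 2 2 0 3] by (simp add: s names algebra_simps)
  then have c\<beta>: "c + \<beta> * c = 0"
    by (metis add.left_inverse)
  then have e220: "c * (1 + \<beta>) = 0"
    by (simp add: algebra_simps)
  have e202: "\<beta> * c = T 0 2 $ 1"
    using sc[of 2 0 2 3] by (simp add: s names algebra_simps)
  have e120: "\<beta> * l - \<beta> * a = \<tau> * c + \<beta> * d"
    using sc[of 1 2 0 3] by (simp add: s names algebra_simps)
  have e102: "\<beta> * a - \<beta> * l = \<tau> * T 0 2 $ 1 + \<beta> * T 0 2 $ 2"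
    using sc[of 1 0 2 3] by (simp add: s names algebra_simps)
  have e012: "\<beta> * T 0 1 $ 1 = \<tau> * T 0 2 $ 1 + T 0 2 $ 2"
    using sc[of 0 1 2 3] by (simp add: s names algebra_simps)
  \<comment> \<open>Left multiplication by \<open>x\<close> induces the negative of \<open>D\<close>.\<close>
  have T01_1: "T 0 1 $ 1 = - a"
    using e201 l by simp
  have T02_1: "T 0 2 $ 1 = - c"
    using e202 c\<beta> by (simp add: add_eq_0_iff)
  have "\<beta> * T 0 1 $ 2 = \<tau> * a + b - \<tau> * l - \<tau> * T 0 1 $ 1"
    unfolding e101 by simp
  also have "\<dots> = \<beta> * (- b)"
    unfolding e110 T01_1 by (simp add: algebra_simps)
  finally have T01_2: "T 0 1 $ 2 = - b" using \<beta> by (simp only: mult_cancel_left) simp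
  have "\<beta> * T 0 2 $ 2 = (\<beta> * a - \<beta> * l) - \<tau> * T 0 2 $ 1"
    unfolding e102 by simp
  also have "\<dots> = - (\<beta> * l - \<beta> * a) + \<tau> * c"
    unfolding T02_1 by simp
  also have "\<dots> = \<beta> * (- d)"
    unfolding e120 by simp
  finally have T02_2: "T 0 2 $ 2 = - d" using \<beta> by (simp only: mult_cancel_left) simp
  \<comment> \<open>The symmetry of \<open>A (D u) v\<close>.\<close>
  have "\<beta> * - a = \<tau> * - c - d"
    using e012 unfolding T01_1 T02_1 T02_2 by simp
  then have "- (\<beta> * a) = - (\<tau> * c + d)" by simp
  then have e012: "\<beta> * a = \<tau> * c + d"
    by (simp only: neg_equal_iff_equal)
  show ?thesis
  proof (cases "\<tau> = 1")
    case True
    then have "\<beta> = -1" using cases by auto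
    have "l = 0" using l e012[symmetric] True \<open>\<beta> = -1\<close> by (simp add: add.assoc)
    then have "a = 0" using e110 True \<open>\<beta> = -1\<close> by simp
    have "d = c" using e120 \<open>l = 0\<close> \<open>a = 0\<close> True \<open>\<beta> = -1\<close> by (simp add: add_eq_0_iff2)
    then have "c = 0" "d = 0" using e012 \<open>a = 0\<close> True \<open>\<beta> = -1\<close> by simp_all
    have s: "T 1 0 $ 1 = 0" "T 2 0 $ 1 = 0" "T 2 0 $ 2 = 0" "T 3 0 $ 3 = 0"
      using \<open>l = 0\<close> \<open>a = 0\<close> \<open>c = 0\<close> \<open>d = 0\<close> by (simp_all add: names)
    have "strictly_triangular T"
      unfolding strictly_triangular_def all4 by (simp add: s s0)
    then show ?thesis ..
  next
    case False
    with cases have \<tau>: "\<tau> = 0" and "\<beta> \<noteq> -1" by auto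
    then have \<beta>1: "1 + \<beta> \<noteq> 0" by (metis add_eq_0_iff)
    have "c = 0" using e220 \<beta>1 by simp
    have "b = 0" using e110 \<tau> \<beta>1 by simp
    have d: "d = \<beta> * a" using e012 \<tau> by simp
    have "l = (1 + \<beta>) * a" using l \<tau> d by (simp add: algebra_simps)
    then have s: "T 1 0 $ 1 = a" "T 1 0 $ 2 = 0" "T 1 0 $ 3 = p"
      "T 2 0 $ 1 = 0" "T 2 0 $ 2 = \<beta> * a" "T 2 0 $ 3 = q"
      "T 3 0 $ 3 = (1 + \<beta>) * a" "T 0 1 $ 1 = - a" "T 0 1 $ 2 = 0"
      "T 0 2 $ 1 = 0" "T 0 2 $ 2 = - (\<beta> * a)" "T 0 0 $ 3 = z3"
      using \<open>c = 0\<close> \<open>b = 0\<close> d T01_1 T01_2 T02_1 T02_2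
      by (simp_all add: names)
    note s = s s0[unfolded \<tau>]
    show ?thesis
    proof (cases "a = 0")
      case True
      then have "strictly_triangular T"
        unfolding strictly_triangular_def all4 by (simp add: s)
      then show ?thesis ..
    next
      case False
      have z1: "T 0 0 $ 1 = 0"
        using sc[of 0 0 0 1] False by (simp add: s)
      have z2: "T 0 0 $ 2 = 0"
        using sc[of 0 0 0 2] False \<beta> by (simp add: s)
      have "a * (\<beta> * T 0 1 $ 3 - p) = 0"
        using sc[of 0 1 0 3] by (simp add: s z1 z2 algebra_simps)
      then have r: "T 0 1 $ 3 = p / \<beta>" using False \<beta> by (simp add: field_simps)
      have "a * (T 0 2 $ 3 - \<beta> * q) = 0"
        using sc[of 0 2 0 3] by (simp add: s z1 z2 algebra_simps)
      then have r': "T 0 2 $ 3 = \<beta> * q" using False by simp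
      note s = s z1 z2 r r'
      \<comment> \<open>The coefficients make \<open>w 1\<close> and \<open>w 2\<close> eigenvectors of right multiplication by \<open>x\<close>, for the eigenvalues
        \<open>a\<close> and \<open>\<beta> * a\<close>, and make the square of \<open>w 0\<close> vanish.\<close>
      define w :: "4 \<Rightarrow> complex ^ 4" where "w i =
        (if i = 0 then (1 / a) *s e 0 - (z3 / (a\<^sup>2 * (1 + \<beta>))) *s e 3
         else if i = 1 then e 1 - (p / (a * \<beta>)) *s e 3
         else if i = 2 then e 2 - (q / a) *s e 3 else e 3)" for i
      have w: "w 0 = (1 / a) *s e 0 - (z3 / (a\<^sup>2 * (1 + \<beta>))) *s e 3"
        "w 1 = e 1 - (p / (a * \<beta>)) *s e 3" "w 2 = e 2 - (q / a) *s e 3" "w 3 = e 3"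
        by (simp_all add: w_def)
      have B: "bracket_of_table T u v $ 0 = 0"
        "bracket_of_table T u v $ 1 = a * (u $ 1 * v $ 0 - u $ 0 * v $ 1)"
        "bracket_of_table T u v $ 2 = \<beta> * a * (u $ 2 * v $ 0 - u $ 0 * v $ 2)"
        "bracket_of_table T u v $ 3 = u $ 2 * v $ 1 + \<beta> * (u $ 1 * v $ 2)
          + (1 + \<beta>) * a * (u $ 3 * v $ 0) + p * (u $ 1 * v $ 0) + q * (u $ 2 * v $ 0)
          + p / \<beta> * (u $ 0 * v $ 1) + \<beta> * q * (u $ 0 * v $ 2) + z3 * (u $ 0 * v $ 0)" for u v
        by (simp_all add: bracket_of_table_nth sum4 s algebra_simps)
      have "algebra_isomorphic (*s) (R1 \<beta>) UNIV (*s) (bracket_of_table T) UNIV"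
        unfolding R1_def
      proof (rule change_of_basis[where b = w])
        fix u :: "complex ^ 4"
        assume z: "(\<Sum>i\<in>UNIV. u $ i *s w i) = 0"
        have "u $ 0 = 0" "u $ 1 = 0" "u $ 2 = 0"
          using arg_cong[OF z, of "\<lambda>x. x $ 0"] arg_cong[OF z, of "\<lambda>x. x $ 1"]
            arg_cong[OF z, of "\<lambda>x. x $ 2"] False
          by (simp_all add: sum4 w e_nth)
        moreover from this have "u $ 3 = 0"
          using arg_cong[OF z, of "\<lambda>x. x $ 3"] by (simp add: sum4 w e_nth)
        ultimately show "u = 0" by (simp add: vec_eq_iff all4)
      next
        have "\<forall>i j. bracket_of_table T (w i) (w j) = (\<Sum>k\<in>UNIV. (if (i, j) = (2, 1) then e 3
           else if (i, j) = (1, 2) then \<beta> *s e 3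
           else if (i, j) = (0, 1) then - e 1
           else if (i, j) = (0, 2) then - (\<beta> *s e 2)
           else if (i, j) = (1, 0) then e 1
           else if (i, j) = (2, 0) then \<beta> *s e 2
           else if (i, j) = (3, 0) then (\<beta> + 1) *s e 3
           else 0) $ k *s w k)"
          using False \<beta> \<beta>1
          by (simp add: all4 vec_eq_iff B sum4 w e_nth) (simp add: field_simps power2_eq_square)
        then show "bracket_of_table T (w i) (w j) = (\<Sum>k\<in>UNIV. (if (i, j) = (2, 1) then e 3
           else if (i, j) = (1, 2) then \<beta> *s e 3
           else if (i, j) = (0, 1) then - e 1
           else if (i, j) = (0, 2) then - (\<beta> *s e 2)
           else if (i, j) = (1, 0) then e 1
           else if (i, j) = (2, 0) then \<beta> *s e 2
           else if (i, j) = (3, 0) then (\<beta> + 1) *s e 3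
           else 0) $ k *s w k)" for i j by blast
      qed
      then show ?thesis using \<tau> by blast
    qed
  qed
qed

text \<open>The nilradical is generated by \<open>e 1\<close>, so the derivation given by right multiplication by \<open>x = e 0\<close> is determined
by the image $a e_1 + b e_2 + c e_3$ of \<open>e 1\<close> and has eigenvalues $a$, $2a$, $3a$. Since \<open>e 2\<close> is a square, it annihilates
the algebra from the right, and so does \<open>e 3\<close>. If $a = 0$, all is triangular. Otherwise \<open>e 1\<close> is replaced by an
eigenvector for $a$, \<open>e 2\<close> by the square of that eigenvector, and \<open>x\<close> is scaled and corrected by multiples
of \<open>e 2\<close> and \<open>e 3\<close>.\<close>

lemma lambda6_extension:
  fixes T :: "4 \<Rightarrow> 4 \<Rightarrow> complex ^ 4"
  assumes leibniz: "\<And>x y z. bracket_of_table T x (bracket_of_table T y z) =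
    bracket_of_table T (bracket_of_table T x y) z - bracket_of_table T (bracket_of_table T x z) y"
    and ideal: "\<And>i. i \<noteq> 0 \<Longrightarrow> T i 0 $ 0 = 0" "\<And>i. i \<noteq> 0 \<Longrightarrow> T 0 i $ 0 = 0"
    and table: "T 1 1 = e 2" "T 1 2 = 0" "T 1 3 = 0"
       "T 2 1 = e 3" "T 2 2 = 0" "T 2 3 = 0" "T 3 1 = 0" "T 3 2 = 0" "T 3 3 = 0"
  shows "strictly_triangular T \<or> algebra_isomorphic (*s) R3 UNIV (*s) (bracket_of_table T) UNIV"
proof -
  define a b c r s z2 z3 where "a = T 1 0 $ 1" and "b = T 1 0 $ 2" and "c = T 1 0 $ 3"
    and "r = T 0 1 $ 2" and "s = T 0 1 $ 3" and "z2 = T 0 0 $ 2" and "z3 = T 0 0 $ 3"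
  note names = a_def b_def c_def r_def s_def z2_def z3_def
  note sc = leibniz_structure_constants[OF leibniz, unfolded sum4]
  have e23: "e 3 $ (0::4) = 0" "e 3 $ (1::4) = 0" "e 3 $ (2::4) = 0" "e 3 $ (3::4) = 1"
    "e 2 $ (0::4) = 0" "e 2 $ (1::4) = 0" "e 2 $ (2::4) = 1" "e 2 $ (3::4) = 0"
    by (simp_all add: e_nth)
  have N: "T 1 0 $ 0 = 0" "T 2 0 $ 0 = 0" "T 3 0 $ 0 = 0" "T 0 1 $ 0 = 0" "T 0 2 $ 0 = 0" "T 0 3 $ 0 = 0"
    by (simp_all add: ideal)
  note s = N table e23
  have "T 0 0 $ 0 = 0" using sc[of 0 0 0 0] by (simp add: s)
  note s = this s
  \<comment> \<open>Both \<open>e 2\<close> and \<open>e 3\<close> annihilate from the right.\<close>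
  have "T 0 2 $ 1 = 0" "T 0 2 $ 2 = 0" "T 0 2 $ 3 = 0"
    using sc[of 0 1 1 1] sc[of 0 1 1 2] sc[of 0 1 1 3] by (simp_all add: s)
  note s = this s
  have "T 0 3 $ 1 = 0" "T 0 3 $ 2 = 0" "T 0 3 $ 3 = 0"
    using sc[of 0 2 1 1] sc[of 0 2 1 2] sc[of 0 2 1 3] by (simp_all add: s)
  note s = this s
  have "T 2 0 $ 1 = 0" using sc[of 1 1 0 1] by (simp add: s)
  moreover have T20_2: "T 2 0 $ 2 = 2 * a" using sc[of 1 1 0 2] by (simp add: s names)
  moreover have "T 2 0 $ 3 = b" using sc[of 1 1 0 3] by (simp add: s names)
  ultimately have s: "T 2 0 $ 1 = 0" "T 2 0 $ 2 = 2 * a" "T 2 0 $ 3 = b"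
    "T 1 0 $ 1 = a" "T 1 0 $ 2 = b" "T 1 0 $ 3 = c"
    "T 0 1 $ 2 = r" "T 0 1 $ 3 = s" "T 0 0 $ 2 = z2" "T 0 0 $ 3 = z3"
    by (simp_all add: names)
  note s = s \<open>T 0 0 $ 0 = 0\<close> \<open>T 0 2 $ 1 = 0\<close> \<open>T 0 2 $ 2 = 0\<close> \<open>T 0 2 $ 3 = 0\<close>
     \<open>T 0 3 $ 1 = 0\<close> \<open>T 0 3 $ 2 = 0\<close> \<open>T 0 3 $ 3 = 0\<close> N table e23
  have "T 3 0 $ 1 = 0" "T 3 0 $ 2 = 0"
    using sc[of 2 1 0 1] sc[of 2 1 0 2] by (simp_all add: s)
  moreover have "T 3 0 $ 3 = 3 * a"
    using sc[of 2 1 0 3] by (simp add: s)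
  moreover have "T 0 1 $ 1 = - a"
    using sc[of 1 0 1 2] by (simp add: s)
  note s = this calculation s
  show ?thesis
  proof (cases "a = 0")
    case True
    then have "strictly_triangular T"
      unfolding strictly_triangular_def all4 by (simp add: s)
    then show ?thesis ..
  next
    case False
    have z1: "T 0 0 $ 1 = 0"
      using sc[of 0 0 0 1] False by (simp add: s)
    have "a * (r - b) = 0"
      using sc[of 0 1 0 2] by (simp add: s z1 algebra_simps)
    then have r: "r = b" using False by simp
    have z2: "z2 = b * b + 2 * (a * s) - a * c"
      using sc[of 0 1 0 3] by (simp add: s z1 r algebra_simps)
    note s = s z1
    \<comment> \<open>Here \<open>p\<close> and \<open>q\<close> make \<open>w 1\<close> an eigenvector; \<open>m\<close> removes the \<open>e 3\<close>-component of the product of \<open>w 0\<close> with \<open>w 1\<close>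
      beyond \<open>- w 1\<close>, and \<open>n\<close> makes the square of \<open>w 0\<close> vanish.\<close>
    define p q m n where "p = - b / a" and "q = (b * b / a - c) / (2 * a)"
      and "m = - q - s / a" and "n = - (z3 / (a * a) + m * b / a) / 3"
    define w :: "4 \<Rightarrow> complex ^ 4" where "w i =
      (if i = 0 then (1 / a) *s e 0 + m *s e 2 + n *s e 3
       else if i = 1 then e 1 + p *s e 2 + q *s e 3
       else if i = 2 then e 2 + p *s e 3 else e 3)" for i
    have w: "w 0 = (1 / a) *s e 0 + m *s e 2 + n *s e 3"
      "w 1 = e 1 + p *s e 2 + q *s e 3" "w 2 = e 2 + p *s e 3" "w 3 = e 3"
      by (simp_all add: w_def)
    have B: "bracket_of_table T u v $ 0 = 0"
      "bracket_of_table T u v $ 1 = a * (u $ 1 * v $ 0 - u $ 0 * v $ 1)"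
      "bracket_of_table T u v $ 2 = u $ 1 * v $ 1 + 2 * a * (u $ 2 * v $ 0)
        + b * (u $ 1 * v $ 0) + b * (u $ 0 * v $ 1) + z2 * (u $ 0 * v $ 0)"
      "bracket_of_table T u v $ 3 = u $ 2 * v $ 1 + 3 * a * (u $ 3 * v $ 0)
        + b * (u $ 2 * v $ 0) + c * (u $ 1 * v $ 0) + s * (u $ 0 * v $ 1) + z3 * (u $ 0 * v $ 0)" for u v
      by (simp_all add: bracket_of_table_nth sum4 s r algebra_simps)
    have "algebra_isomorphic (*s) R3 UNIV (*s) (bracket_of_table T) UNIV"
      unfolding R3_def
    proof (rule change_of_basis[where b = w])
      fix u :: "complex ^ 4"
      assume z: "(\<Sum>i\<in>UNIV. u $ i *s w i) = 0"
      have u01: "u $ 0 = 0" "u $ 1 = 0"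
        using arg_cong[OF z, of "\<lambda>x. x $ 0"] arg_cong[OF z, of "\<lambda>x. x $ 1"] False
        by (simp_all add: sum4 w e_nth)
      have u2: "u $ 2 = 0"
        using u01 arg_cong[OF z, of "\<lambda>x. x $ 2"] by (simp add: sum4 w e_nth)
      have "u $ 3 = 0"
        using u01 u2 arg_cong[OF z, of "\<lambda>x. x $ 3"] by (simp add: sum4 w e_nth)
      with u01 u2 show "u = 0" by (simp add: vec_eq_iff all4)
    next
      have "\<forall>i j. bracket_of_table T (w i) (w j) = (\<Sum>k\<in>UNIV. (if (i, j) = (1, 1) then e 2
           else if (i, j) = (2, 1) then e 3
           else if (i, j) = (0, 1) then - e 1
           else if (i, j) = (1, 0) then e 1
           else if (i, j) = (2, 0) then 2 *s e 2
           else if (i, j) = (3, 0) then 3 *s e 3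
           else 0) $ k *s w k)"
        using False
        by (simp add: all4 vec_eq_iff B sum4 w e_nth)
          (simp add: p_def q_def m_def n_def z2 field_simps)
      then show "bracket_of_table T (w i) (w j) = (\<Sum>k\<in>UNIV. (if (i, j) = (1, 1) then e 2
           else if (i, j) = (2, 1) then e 3
           else if (i, j) = (0, 1) then - e 1
           else if (i, j) = (1, 0) then e 1
           else if (i, j) = (2, 0) then 2 *s e 2
           else if (i, j) = (3, 0) then 3 *s e 3
           else 0) $ k *s w k)" for i j by blast
    qed
    then show ?thesis ..
  qed
qed

section \<open>The classification\<close>

text \<open>A nilradical isomorphic to an algebra on $\mathbb{C}^3$ has dimension three, hence it is a hyperplane, and a basis of it is
completed by any \<open>x\<close> outside. In this basis the given table of the nilradical reappears, and the coordinate
\<open>0\<close> of a product vanishes unless both factors are \<open>x\<close>. The table cannot be strictly triangular: the whole algebra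
would be a nilpotent ideal and thus be contained in the nilradical.\<close>

lemma structure_constants_exist:
  fixes smul :: "complex \<Rightarrow> 'a::ab_group_add \<Rightarrow> 'a"
  assumes L: "leibniz_algebra smul bracket"
    and dim: "vector_space.dim smul (UNIV :: 'a set) = 4"
    and nilradical: "leibniz_algebra.is_nilradical smul bracket N"
    and iso: "algebra_isomorphic (*s) (bracket_of_table H) (UNIV :: (complex ^ 3) set) smul bracket N"
  obtains T :: "4 \<Rightarrow> 4 \<Rightarrow> complex ^ 4"
  where "algebra_isomorphic (*s) (bracket_of_table T) UNIV smul bracket UNIV"
    and "\<And>x y z. bracket_of_table T x (bracket_of_table T y z) =
      bracket_of_table T (bracket_of_table T x y) z - bracket_of_table T (bracket_of_table T x z) y"
    and "\<And>i. i \<noteq> 0 \<Longrightarrow> T i 0 $ 0 = 0" "\<And>i. i \<noteq> 0 \<Longrightarrow> T 0 i $ 0 = 0"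
    and "\<And>i j. bracket_of_table T (nil_basis i) (nil_basis j) = (\<Sum>k\<in>UNIV. H i j $ k *s nil_basis k)"
    and "\<not> strictly_triangular T"
proof -
  interpret leibniz_algebra smul bracket by fact
  have ideal: "is_ideal N" and maximal: "\<And>I. is_ideal I \<Longrightarrow> nilpotent I \<Longrightarrow> I \<subseteq> N"
    using nilradical by (auto simp: is_nilradical_def)
  then have sub: "subspace N" by (simp add: is_ideal_def)
  obtain f where f: "bij_betw f UNIV N" "\<And>u v. f (u + v) = f u + f v"
      "\<And>c u. f (c *s u) = smul c (f u)" "\<And>u v. f (bracket_of_table H u v) = bracket (f u) (f v)"
    using iso unfolding algebra_isomorphic_def by auto
  interpret f: Vector_Spaces.linear "(*s)" smul f
    by unfold_locales (simp_all add: f)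
  obtain Bs where Bs: "independent Bs" "span Bs = UNIV" "card Bs = 4"
    using basis_exists[of UNIV] dim by (metis top.extremum_uniqueI)
  then have "finite Bs" by (metis card.infinite zero_neq_numeral)
  interpret fd: finite_dimensional_vector_space smul Bs
    using Bs \<open>finite Bs\<close> by unfold_locales auto
  interpret vp: finite_dimensional_vector_space_pair
      "(*s) :: complex \<Rightarrow> complex ^ 3 \<Rightarrow> complex ^ 3" cart_basis smul Bs
    by unfold_locales
  interpret vp4: finite_dimensional_vector_space_pair
      "(*s) :: complex \<Rightarrow> complex ^ 4 \<Rightarrow> complex ^ 4" cart_basis smul Bs
    by unfold_locales
  have fN: "f u \<in> N" for u using f(1) by (auto simp: bij_betw_def)
  have "inj f" using f(1) by (auto simp: bij_betw_def)
  then have f_zero: "f u = 0 \<longleftrightarrow> u = 0" for u using f.zero by (metis injD)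
  have "N \<noteq> UNIV"
  proof
    assume "N = UNIV"
    then have "range f = UNIV" using f(1) by (simp add: bij_betw_def)
    moreover have "dim (range f) = vec.dim (UNIV :: (complex ^ 3) set)"
      by (rule vp.dim_image_eq[OF f.linear_axioms]) (simp add: \<open>inj f\<close>)
    ultimately show False using dim unfolding vec_dim_card by simp
  qed
  then obtain x where x: "x \<notin> N" by auto
  define b :: "4 \<Rightarrow> 'a" where "b i = (if i = 0 then x else if i = 1 then f (e 1)
    else if i = 2 then f (e 2) else f (e 3))" for i
  have b: "b 0 = x" "b 1 = f (e 1)" "b 2 = f (e 2)" "b 3 = f (e 3)"
    by (simp_all add: b_def)
  define \<phi> where "\<phi> u = (\<Sum>i\<in>UNIV. smul (u $ i) (b i))" for u :: "complex ^ 4"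
  have \<phi>_linear: "Vector_Spaces.linear (*s) smul \<phi>"
    unfolding \<phi>_def by (rule linear_combination_linear) (rule vector_space_axioms)
  interpret \<phi>: Vector_Spaces.linear "(*s)" smul \<phi> by (rule \<phi>_linear)
  have \<phi>_split: "\<phi> u = smul (u $ 0) x + f (u $ 1 *s e 1 + u $ 2 *s e 2 + u $ 3 *s e 3)" for u
    by (simp add: \<phi>_def sum4 b f.add f.scale add.assoc)
  have \<phi>_in_N: "\<phi> u \<in> N \<longleftrightarrow> u $ 0 = 0" for u
  proof
    assume u: "\<phi> u \<in> N"
    have "smul (u $ 0) x = \<phi> u - f (u $ 1 *s e 1 + u $ 2 *s e 2 + u $ 3 *s e 3)"
      by (simp add: \<phi>_split)
    then have "smul (u $ 0) x \<in> N"
      using subspace_diff[OF sub u fN] by simp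
    then have "smul (inverse (u $ 0)) (smul (u $ 0) x) \<in> N"
      by (rule subspace_scale[OF sub])
    then show "u $ 0 = 0" using x by (cases "u $ 0 = 0") simp_all
  qed (simp add: \<phi>_split fN)
  have "inj \<phi>"
  proof -
    have "u = 0" if "\<phi> u = 0" for u
    proof -
      have u0: "u $ 0 = 0" using \<phi>_in_N[of u] that subspace_0[OF sub] by simp
      then have "u $ 1 *s e 1 + u $ 2 *s e 2 + u $ 3 *s e 3 = (0 :: complex ^ 3)"
        using that f_zero unfolding \<phi>_split by simp
      then show ?thesis using u0 by (simp add: vec_eq_iff all4 forall_3 e_nth)
    qed
    then show ?thesis using vp4.linear_inj_iff_eq_0[OF \<phi>_linear] by blast
  qed
  have "surj \<phi>"
    using vp4.linear_injective_imp_surjective[OF \<phi>_linear \<open>inj \<phi>\<close>] dim dim_complex_4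
    by (simp del: vec.dim_UNIV fd.dim_UNIV)
  have bij: "bij \<phi>" using \<open>inj \<phi>\<close> \<open>surj \<phi>\<close> by (simp add: bij_def)
  define T where "T i j = inv \<phi> (bracket (b i) (b j))" for i j
  have table: "bracket (b i) (b j) = \<phi> (T i j)" for i j
    using \<open>surj \<phi>\<close> by (simp add: T_def surj_f_inv_f)
  then have table': "bracket (b i) (b j) = (\<Sum>k\<in>UNIV. smul (T i j $ k) (b k))" for i j
    by (simp add: \<phi>_def)
  have hom: "\<phi> (bracket_of_table T u v) = bracket (\<phi> u) (\<phi> v)" for u v
    using linear_combination_bracket[OF vector_space_axioms linear_bracket_left linear_bracket_right table']
    unfolding \<phi>_def .
  show thesis
  proof (rule that[of T])
    show "algebra_isomorphic (*s) (bracket_of_table T) UNIV smul bracket UNIV"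
      by (rule bracket_of_table_isomorphic_if_basis[OF vector_space_axioms linear_bracket_left
          linear_bracket_right bij[unfolded \<phi>_def] table'])
    show "bracket_of_table T u (bracket_of_table T v w) =
      bracket_of_table T (bracket_of_table T u v) w - bracket_of_table T (bracket_of_table T u w) v" for u v w
      by (rule injD[OF \<open>inj \<phi>\<close>]) (simp add: hom \<phi>.diff leibniz_identity[symmetric])
    have bN: "b i \<in> N" if "i \<noteq> 0" for i
      using that fN by (simp add: b_def)
    show "T i 0 $ 0 = 0" "T 0 i $ 0 = 0" if "i \<noteq> 0" for i
      using bN[OF that] ideal by (simp_all add: table flip: \<phi>_in_N) (simp_all add: is_ideal_def flip: table)
    have \<phi>_nil: "\<phi> (\<Sum>k\<in>UNIV. u $ k *s nil_basis k) = f u" for u :: "complex ^ 3"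
    proof -
      have "u = u $ 1 *s e 1 + u $ 2 *s e 2 + u $ 3 *s e 3"
        by (simp add: vec_eq_iff forall_3 e_nth)
      then show ?thesis
        by (simp add: \<phi>_split sum_3 nil_basis_simps e_nth)
    qed
    have "\<phi> (nil_basis i) = f (e i)" for i
    proof -
      have "(\<Sum>k\<in>UNIV. e i $ k *s nil_basis k) = nil_basis i"
        using exhaust_3[of i] by (auto simp: sum_3 e_nth)
      then show ?thesis using \<phi>_nil[of "e i"] by simp
    qed
    then show "bracket_of_table T (nil_basis i) (nil_basis j) = (\<Sum>k\<in>UNIV. H i j $ k *s nil_basis k)" for i j
      by (intro injD[OF \<open>inj \<phi>\<close>]) (simp add: hom \<phi>_nil f(4)[symmetric] bracket_of_table_e)
    show "\<not> strictly_triangular T"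
    proof
      assume tri: "strictly_triangular T"
      have "nilpotent UNIV"
      proof (rule nilpotent_if_coordinates_lowered[where d = 4 and c = "\<lambda>k w. inv \<phi> w $ of_nat k"])
        have inv: "inv \<phi> (\<phi> u) = u" for u using \<open>inj \<phi>\<close> by simp
        have surj: "\<exists>u. w = \<phi> u" for w using \<open>surj \<phi>\<close> by (rule surjD)
        show "inv \<phi> (v + w) $ of_nat k = inv \<phi> v $ of_nat k + inv \<phi> w $ of_nat k" for k v w
          using surj[of v] surj[of w] by (auto simp: inv simp flip: \<phi>.add)
        show "inv \<phi> (smul c w) $ of_nat k = c * inv \<phi> w $ of_nat k" for k c w
          using surj[of w] by (auto simp: inv simp flip: \<phi>.scale)
        show "w = 0" if "\<And>k. k < 4 \<Longrightarrow> inv \<phi> w $ of_nat k = 0" for w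
        proof -
          have "inv \<phi> w = 0"
            using that[of 0] that[of 1] that[of 2] that[of 3] by (simp add: vec_eq_iff all4)
          then show ?thesis using surj[of w] by (auto simp: inv)
        qed
        show "inv \<phi> (bracket v w) $ of_nat k = 0"
          if "k < 4" and z: "\<And>i. i < k \<Longrightarrow> inv \<phi> v $ of_nat i = 0" for v w and k :: nat
        proof -
          obtain u u' where u: "v = \<phi> u" "w = \<phi> u'" using surj by blast
          have "k = 0 \<or> k = 1 \<or> k = 2 \<or> k = 3" using \<open>k < 4\<close> by linarith
          then show ?thesis
            using tri z[of 0] z[of 1] z[of 2]
            by (auto simp: u inv bracket_of_table_nth sum4 strictly_triangular_def simp flip: hom)
        qed
      qed
      then have "UNIV \<subseteq> N" by (intro maximal) (simp_all add: is_ideal_def)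
      then show False using x by auto
    qed
  qed
qed

text \<open>The value \<open>\<alpha> = 1 / 4\<close> does not occur, because every extension of the corresponding nilradical by one dimension is
nilpotent.\<close>

lemma classification:
  fixes smul :: "complex \<Rightarrow> 'a::ab_group_add \<Rightarrow> 'a"
  assumes "solvable_4_rigid_nilradical_3 smul bracket"
  shows "(\<exists>\<alpha>. \<alpha> \<noteq> 0 \<and> \<alpha> \<noteq> 1/4 \<and>
             algebra_isomorphic smul bracket UNIV (*s) (R1 (beta \<alpha>)) UNIV) \<or>
          algebra_isomorphic smul bracket UNIV (*s) R2 UNIV \<or>
          algebra_isomorphic smul bracket UNIV (*s) R3 UNIV"
proof -
  interpret leibniz_algebra smul bracket
    using assms by (simp add: solvable_4_rigid_nilradical_3_def)
  have dim: "dim (UNIV :: 'a set) = 4"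
    using assms by (simp add: solvable_4_rigid_nilradical_3_def)
  obtain N where N: "is_nilradical N" "is_rigid_nilpotent_3 smul bracket N"
    using assms by (auto simp: solvable_4_rigid_nilradical_3_def)
  have N_sym: "algebra_isomorphic (*s) br UNIV smul bracket N"
    if "algebra_isomorphic smul bracket N (*s) br UNIV" for br :: "complex ^ 3 \<Rightarrow> complex ^ 3 \<Rightarrow> complex ^ 3"
  proof (rule algebra_isomorphic_sym[OF that])
    have "is_ideal N" using N(1) by (simp add: is_nilradical_def)
    then have sub: "subspace N" and "\<And>u v. v \<in> N \<Longrightarrow> bracket u v \<in> N"
      by (simp_all add: is_ideal_def)
    then show "bracket u v \<in> N" if "u \<in> N" "v \<in> N" for u v
      using that by blast
    show "u + v \<in> N" if "u \<in> N" "v \<in> N" for u v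
      using sub that by (rule subspace_add)
    show "smul c u \<in> N" if "u \<in> N" for c u
      using sub that by (rule subspace_scale)
  qed
  have UNIV_sym: "algebra_isomorphic smul bracket UNIV (*s) R UNIV"
    if "algebra_isomorphic (*s) (bracket_of_table T) UNIV smul bracket UNIV"
      "algebra_isomorphic (*s) R UNIV (*s) (bracket_of_table T) UNIV"
    for T :: "4 \<Rightarrow> 4 \<Rightarrow> complex ^ 4" and R
    by (rule algebra_isomorphic_sym[OF algebra_isomorphic_trans[OF that(2,1)]]) simp_all
  have plane: "\<tau> = 0 \<and> algebra_isomorphic smul bracket UNIV (*s) (R1 \<beta>) UNIV"
    if iso: "algebra_isomorphic (*s) (plane_form_algebra \<tau> \<beta>) UNIV smul bracket N"
      and cases: "\<tau> = 0 \<and> \<beta> \<noteq> 0 \<and> \<beta> \<noteq> -1 \<or> \<tau> = 1 \<and> \<beta> = -1" for \<tau> \<beta>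
  proof -
    obtain T :: "4 \<Rightarrow> 4 \<Rightarrow> complex ^ 4" where T:
      "algebra_isomorphic (*s) (bracket_of_table T) UNIV smul bracket UNIV"
      "\<And>x y z. bracket_of_table T x (bracket_of_table T y z) =
        bracket_of_table T (bracket_of_table T x y) z - bracket_of_table T (bracket_of_table T x z) y"
      "\<And>i. i \<noteq> 0 \<Longrightarrow> T i 0 $ 0 = 0" "\<And>i. i \<noteq> 0 \<Longrightarrow> T 0 i $ 0 = 0"
      "\<And>i j. bracket_of_table T (nil_basis i) (nil_basis j) = (\<Sum>k\<in>UNIV. (if (i, j) = (1, 1) then \<tau> *s e 3
        else if (i, j) = (1, 2) then \<beta> *s e 3 else if (i, j) = (2, 1) then e 3 else 0) $ k *s nil_basis k)"
      "\<not> strictly_triangular T"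
      using structure_constants_exist[OF leibniz_algebra_axioms dim N(1) iso[unfolded plane_form_algebra_def]]
      by blast
    have "strictly_triangular T \<or> \<tau> = 0 \<and> algebra_isomorphic (*s) (R1 \<beta>) UNIV (*s) (bracket_of_table T) UNIV"
      using T(5)[of 1 1] T(5)[of 1 2] T(5)[of 1 3] T(5)[of 2 1] T(5)[of 2 2] T(5)[of 2 3]
        T(5)[of 3 1] T(5)[of 3 2] T(5)[of 3 3]
      by (intro plane_form_extension[OF T(2-4) _ _ _ _ _ _ _ _ _ cases])
        (simp_all add: nil_basis_simps bracket_of_table_e sum_3 e_nth)
    then show ?thesis using T(1,6) UNIV_sym by blast
  qed
  from N(2) consider (l4) \<alpha> where "\<alpha> \<noteq> 0" "algebra_isomorphic smul bracket N (*s) (lambda4 \<alpha>) UNIV"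
    | (l5) "algebra_isomorphic smul bracket N (*s) lambda5 UNIV"
    | (l6) "algebra_isomorphic smul bracket N (*s) lambda6 UNIV"
    unfolding is_rigid_nilpotent_3_def by blast
  then show ?thesis
  proof cases
    case l4
    note l4_N = N_sym[OF l4(2)]
    show ?thesis
    proof (cases "\<alpha> = 1 / 4")
      case True
      then have "algebra_isomorphic (*s) (plane_form_algebra 1 (- 1)) UNIV smul bracket N"
        using algebra_isomorphic_trans[OF plane_form_isomorphic_lambda4_quarter] l4_N by blast
      from plane[OF this] show ?thesis by simp
    next
      case False
      note \<beta> = beta_properties[OF l4(1) False]
      show ?thesis
        using plane[OF algebra_isomorphic_trans[OF \<beta>(5) l4_N]] \<beta>(1,2) l4(1) False by blast
    qed
  next
    case l5
    have "(1 :: complex) \<noteq> - 1" by simp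
    with plane[OF N_sym[OF l5, unfolded lambda5_eq]] show ?thesis
      unfolding R2_eq_R1 by simp
  next
    case l6
    obtain T :: "4 \<Rightarrow> 4 \<Rightarrow> complex ^ 4" where T:
      "algebra_isomorphic (*s) (bracket_of_table T) UNIV smul bracket UNIV"
      "\<And>x y z. bracket_of_table T x (bracket_of_table T y z) =
        bracket_of_table T (bracket_of_table T x y) z - bracket_of_table T (bracket_of_table T x z) y"
      "\<And>i. i \<noteq> 0 \<Longrightarrow> T i 0 $ 0 = 0" "\<And>i. i \<noteq> 0 \<Longrightarrow> T 0 i $ 0 = 0"
      "\<And>i j. bracket_of_table T (nil_basis i) (nil_basis j) = (\<Sum>k\<in>UNIV. (if (i, j) = (1, 1) then e 2
        else if (i, j) = (2, 1) then e 3 else 0) $ k *s nil_basis k)"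
      "\<not> strictly_triangular T"
      using structure_constants_exist[OF leibniz_algebra_axioms dim N(1) N_sym[OF l6, unfolded lambda6_def]]
      by blast
    have "strictly_triangular T \<or> algebra_isomorphic (*s) R3 UNIV (*s) (bracket_of_table T) UNIV"
      using T(5)[of 1 1] T(5)[of 1 2] T(5)[of 1 3] T(5)[of 2 1] T(5)[of 2 2] T(5)[of 2 3]
        T(5)[of 3 1] T(5)[of 3 2] T(5)[of 3 3]
      by (intro lambda6_extension[OF T(2-4)])
        (simp_all add: nil_basis_simps bracket_of_table_e sum_3 e_nth)
    then show ?thesis using T(1,6) UNIV_sym by blast
  qed
qed

theorem theorem3p10:
  shows
    "(\<forall>\<alpha>. \<alpha> \<noteq> 0 \<and> \<alpha> \<noteq> 1/4 \<longrightarrow> solvable_4_rigid_nilradical_3 (*s) (R1 (beta \<alpha>))) \<and>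
     solvable_4_rigid_nilradical_3 (*s) R2 \<and>
     solvable_4_rigid_nilradical_3 (*s) R3 \<and>
     (\<forall>\<alpha> \<alpha>'. \<alpha> \<noteq> 0 \<and> \<alpha> \<noteq> 1/4 \<and> \<alpha>' \<noteq> 0 \<and> \<alpha>' \<noteq> 1/4 \<and>
        algebra_isomorphic (*s) (R1 (beta \<alpha>)) UNIV (*s) (R1 (beta \<alpha>')) UNIV \<longrightarrow> \<alpha> = \<alpha>') \<and>
     (\<forall>\<alpha>. \<alpha> \<noteq> 0 \<and> \<alpha> \<noteq> 1/4 \<longrightarrow>
        \<not> algebra_isomorphic (*s) (R1 (beta \<alpha>)) UNIV (*s) R2 UNIV \<and>
        \<not> algebra_isomorphic (*s) (R1 (beta \<alpha>)) UNIV (*s) R3 UNIV) \<and>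
     \<not> algebra_isomorphic (*s) R2 UNIV (*s) R3 UNIV \<and>
     (\<forall>(smul :: complex \<Rightarrow> 'a::ab_group_add \<Rightarrow> 'a) bracket.
        solvable_4_rigid_nilradical_3 smul bracket \<longrightarrow>
          (\<exists>\<alpha>. \<alpha> \<noteq> 0 \<and> \<alpha> \<noteq> 1/4 \<and>
             algebra_isomorphic smul bracket UNIV (*s) (R1 (beta \<alpha>)) UNIV) \<or>
          algebra_isomorphic smul bracket UNIV (*s) R2 UNIV \<or>
          algebra_isomorphic smul bracket UNIV (*s) R3 UNIV)"
proof (intro conjI allI impI)
  fix \<alpha> \<alpha>' :: complex
  assume *: "\<alpha> \<noteq> 0 \<and> \<alpha> \<noteq> 1/4 \<and> \<alpha>' \<noteq> 0 \<and> \<alpha>' \<noteq> 1/4 \<and>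
        algebra_isomorphic (*s) (R1 (beta \<alpha>)) UNIV (*s) (R1 (beta \<alpha>')) UNIV"
  let ?\<beta> = "beta \<alpha>" and ?\<gamma> = "beta \<alpha>'"
  have \<beta>: "?\<beta> \<noteq> 0" "?\<beta> \<noteq> 1" "\<alpha> = - ?\<beta> / (1 - ?\<beta>)\<^sup>2" and \<gamma>: "\<alpha>' = - ?\<gamma> / (1 - ?\<gamma>)\<^sup>2"
    using * beta_properties by blast+
  have "?\<gamma> = ?\<beta> \<or> ?\<beta> * ?\<gamma> = 1"
    using * \<beta>(1) by (intro R1_isomorphic_R1_imp) auto
  then show "\<alpha> = \<alpha>'"
  proof
    assume "?\<gamma> = ?\<beta>"
    then show ?thesis using \<beta>(3) \<gamma> by simp
  next
    assume "?\<beta> * ?\<gamma> = 1"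
    then have "?\<gamma> = 1 / ?\<beta>" using \<beta>(1) by (simp add: field_simps)
    then have "\<alpha>' = - (1 / ?\<beta>) / (1 - 1 / ?\<beta>)\<^sup>2" using \<gamma> by simp
    also have "\<dots> = - ?\<beta> / (1 - ?\<beta>)\<^sup>2"
    proof -
      have "1 - 1 / ?\<beta> = - (1 - ?\<beta>) / ?\<beta>" using \<beta>(1) by (simp add: field_simps)
      then show ?thesis using \<beta>(1,2) by (simp add: power_divide power2_eq_square field_simps)
    qed
    finally show ?thesis using \<beta>(3) by simp
  qed
next
  fix \<alpha> :: complex
  assume *: "\<alpha> \<noteq> 0 \<and> \<alpha> \<noteq> 1/4"
  show "\<not> algebra_isomorphic (*s) (R1 (beta \<alpha>)) UNIV (*s) R2 UNIV"
    using R1_isomorphic_R1_imp[of "beta \<alpha>" 1] beta_properties[of \<alpha>] * unfolding R2_eq_R1 by auto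
next
  show "\<not> algebra_isomorphic (*s) R2 UNIV (*s) R3 UNIV"
    unfolding R2_eq_R1 by (rule R1_not_isomorphic_R3)
qed (use classification in
    \<open>blast intro: solvable_4_R1_beta solvable_4_R2 solvable_4_R3 dest: R1_not_isomorphic_R3[THEN notE]\<close>)+

end
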